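(* Let $A,B\in\mathbb{Z}$ with $2\nmid B$, and let $(u_n)_{n\ge0}$ be the Lucas sequence of the first kind given by $u_0=0$, $u_1=1$, $u_{n+2}=Au_{n+1}+Bu_n$ for $n\ge0$. Assume that it is nondegenerate and that $u_n\ge0$ for all $n\in\mathbb{N}$. Let $\pi=4$ if $2\mid A$ and $\pi=6$ if $2\nmid A$. Then the set of $n\in\mathbb{N}$ such that $u_n$ is not a sum of three squares of integers is a finite union of sets of the form $$\{2^t\pi l+j:\ l\in\mathbb{N}\}$$ and $$\{2^{t+2k}\pi(8l+c):\ k,l\in\mathbb{N}\},$$ where $t\in\mathbb{N}$, $j\in\{1,\ldots,2^t\pi-1\}$, and $c\in\{0,1,\ldots,7\}$.
   Context: $\mathbb{N}=\{0,1,2,\ldots\}$. The sequence $(u_n)$ is nondegenerate if the ratio of the complex roots $\alpha,\beta$ of $X^2-AX-B$ is not a root of unity. The parameters $t,j,c$ may differ from one set of the union to another. *)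

theory Defs
  imports Complex_Main "HOL-Computational_Algebra.Polynomial"
begin

fun lucas_u :: "int \<Rightarrow> int \<Rightarrow> nat \<Rightarrow> int" where
  "lucas_u A B 0 = 0"
| "lucas_u A B (Suc 0) = 1"
| "lucas_u A B (Suc (Suc n)) = A * lucas_u A B (Suc n) + B * lucas_u A B n"

definition root_of_unity :: "complex \<Rightarrow> bool" where
  "root_of_unity z \<longleftrightarrow> (\<exists>n::nat. n > 0 \<and> z ^ n = 1)"

text \<open>The roots \<open>\<alpha>\<close>, \<open>\<beta>\<close> of \<open>X\<^sup>2 - A X - B\<close> are taken with multiplicity, in either order;
  a double root has ratio 1 and counts as degenerate. The notion is meant for \<open>B \<noteq> 0\<close>,
  where both roots are nonzero.\<close>

definition nondegenerate :: "int \<Rightarrow> int \<Rightarrow> bool" where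
  "nondegenerate A B \<longleftrightarrow>
     (\<forall>\<alpha> \<beta> :: complex. [:- of_int B, - of_int A, 1:] = [:- \<alpha>, 1:] * [:- \<beta>, 1:]
        \<longrightarrow> \<not> root_of_unity (\<alpha> / \<beta>))"

definition sum_of_three_squares :: "int \<Rightarrow> bool" where
  "sum_of_three_squares m \<longleftrightarrow> (\<exists>x y z :: int. m = x\<^sup>2 + y\<^sup>2 + z\<^sup>2)"

end

theory Submission
  imports Defs "HOL-Number_Theory.Number_Theory" "HOL-Computational_Algebra.Squarefree"
    "HOL-Analysis.Summation_Tests"
begin

text \<open>
  By the three-square theorem of Legendre and Gauss, \<open>u\<^sub>n\<close> fails to be a sum of three squares iff
  \<open>u\<^sub>n = 4\<^sup>a (8 b + 7)\<close>, a condition on the 2-adic valuation and on the odd part modulo 8.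
  For \<open>q = 8 \<pi>\<close>, which is a period modulo 16, one has \<open>u\<^sub>2\<^sub>n = u\<^sub>n v\<^sub>n\<close> with \<open>v\<^sub>n \<equiv> 2 (mod 16)\<close> at multiples
  \<open>n\<close> of \<open>q\<close>, so that \<open>u\<close> at index \<open>2\<^sup>s l q\<close> is \<open>2\<^sup>s u\<^sub>q w\<close> with \<open>w \<equiv> l (mod 8)\<close>: these indices contribute a
  single set of the second kind. If \<open>q\<close> does not divide \<open>n\<close>, the valuation of \<open>u\<^sub>n\<close> is bounded because
  \<open>u\<^sub>n\<close> divides \<open>u\<^sub>n\<^sub>q\<close>, and periodicity modulo a fixed power of 2 yields sets of the first kind.

  For the three-square theorem with squarefree \<open>n\<close>, one looks for \<open>t\<close> prime to \<open>n\<close> such that \<open>-t\<close> is a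
  square modulo \<open>n\<close> and \<open>-n\<close> is a square modulo \<open>t\<close>; then \<open>n\<close> is a coefficient of a positive ternary
  form of determinant one, and every such form is equivalent to \<open>x\<^sup>2 + y\<^sup>2 + z\<^sup>2\<close>. Instead of taking \<open>t\<close>
  prime and invoking Dirichlet's theorem, we weight \<open>t\<close> by \<open>\<Sum>\<^bsub>d | t\<^esub> (-n/d)\<close> and use only that sums of
  such weights over \<open>sqrt t\<close>, twisted by real characters, stay bounded when both characters
  involved are nontrivial, whereas the untwisted sum diverges already over the squares.
\<close>

section \<open>2-adic behaviour of Lucas sequences\<close>

lemma lucas_u_add:
  "lucas_u A B (m + Suc n) = lucas_u A B (Suc m) * lucas_u A B (Suc n) + B * lucas_u A B m * lucas_u A B n"
proof (induction A B n arbitrary: m rule: lucas_u.induct)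
  case (3 A B n)
  have "lucas_u A B (m + Suc (Suc (Suc n))) = A * lucas_u A B (m + Suc (Suc n)) + B * lucas_u A B (m + Suc n)"
    by simp
  also have "\<dots> = lucas_u A B (Suc m) * lucas_u A B (Suc (Suc (Suc n))) + B * lucas_u A B m * lucas_u A B (Suc (Suc n))"
    unfolding 3(1)[of m] 3(2)[of m] by (simp add: algebra_simps)
  finally show ?case .
qed (simp_all add: algebra_simps)

lemma lucas_u_double: "lucas_u A B (2 * n) = lucas_u A B n * (2 * lucas_u A B (Suc n) - A * lucas_u A B n)"
proof (cases n)
  case (Suc k)
  have "2 * n = n + Suc k" using Suc by simp
  then show ?thesis unfolding \<open>2 * n = n + Suc k\<close> lucas_u_add using Suc by (simp add: algebra_simps)
qed simp

lemma lucas_u_double_Suc: "lucas_u A B (Suc (2 * n)) = (lucas_u A B (Suc n))\<^sup>2 + B * (lucas_u A B n)\<^sup>2"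
  using lucas_u_add[of A B n n] by (simp add: mult_2 power2_eq_square)

text \<open>The bracket is \<open>B\<close> times the term preceding index \<open>m\<close>; written
  without a predecessor, the formula also covers \<open>m = 0\<close>.\<close>

lemma lucas_u_shift: 
  "lucas_u A B (m + n) = lucas_u A B m * lucas_u A B (Suc n) + (lucas_u A B (Suc m) - A * lucas_u A B m) * lucas_u A B n"
proof (cases n)
  case (Suc k)
  then show ?thesis using lucas_u_add[of A B m k] by (simp add: algebra_simps)
qed simp

definition lucas_period :: "int \<Rightarrow> int \<Rightarrow> nat \<Rightarrow> int \<Rightarrow> bool" where
  "lucas_period A B q m \<longleftrightarrow> [lucas_u A B q = 0] (mod m) \<and> [lucas_u A B (Suc q) = 1] (mod m)"

lemma lucas_period_add:
  assumes "lucas_period A B q m"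
  shows "[lucas_u A B (n + q) = lucas_u A B n] (mod m)"
proof -
  have "[lucas_u A B (n + q) = lucas_u A B n * 1 + (lucas_u A B (Suc n) - A * lucas_u A B n) * 0] (mod m)"
    unfolding lucas_u_shift using assms unfolding lucas_period_def by (intro cong_add cong_mult cong_refl) auto
  then show ?thesis by simp
qed

lemma lucas_period_add_mult:
  assumes "lucas_period A B q m"
  shows "[lucas_u A B (n + l * q) = lucas_u A B n] (mod m)"
proof (induction l)
  case (Suc l)
  have "[lucas_u A B ((n + l * q) + q) = lucas_u A B (n + l * q)] (mod m)"
    by (rule lucas_period_add[OF assms])
  then show ?case using Suc cong_trans by (simp add: algebra_simps) blast
qed simp

lemma lucas_period_mult:
  assumes "lucas_period A B q m"
  shows "lucas_period A B (l * q) m"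
  using lucas_period_add_mult[OF assms, of 0 l] lucas_period_add_mult[OF assms, of 1 l]
  by (simp add: lucas_period_def)

text \<open>The doubling formulas gain one factor 2: \<open>u\<close> is multiplied by an even
  number, and squaring \<open>1 + 2 ^ Suc k * y\<close> doubles the deviation from 1. As the
  exponent is at least 1, the square of \<open>2 ^ Suc k\<close> vanishes modulo
  \<open>2 ^ Suc (Suc k)\<close>.\<close>

lemma lucas_period_double:
  assumes "lucas_period A B q (2 ^ Suc k)"
  shows "lucas_period A B (2 * q) (2 ^ Suc (Suc k))"
proof -
  define u v where "u = lucas_u A B q" and "v = lucas_u A B (Suc q)"
  obtain x where x: "u = 2 ^ Suc k * x" using assms by (auto simp: lucas_period_def cong_0_iff u_def)
  obtain y where y: "v = 1 + 2 ^ Suc k * y"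
    using assms by (auto simp: lucas_period_def v_def cong_iff_dvd_diff dvd_def algebra_simps)
  have e: "(2::int) ^ Suc (Suc k) = 2 * 2 ^ Suc k" by simp
  have "lucas_u A B (2 * q) = 2 ^ Suc (Suc k) * (x * (v - A * (2 ^ k * x)))"
    unfolding lucas_u_double u_def[symmetric] v_def[symmetric] e x by (simp add: algebra_simps)
  moreover have "lucas_u A B (Suc (2 * q)) = 1 + 2 ^ Suc (Suc k) * (y + 2 ^ k * y\<^sup>2 + B * 2 ^ k * x\<^sup>2)"
    unfolding lucas_u_double_Suc u_def[symmetric] v_def[symmetric] x y by (simp add: algebra_simps power2_eq_square)
  ultimately show ?thesis by (simp add: lucas_period_def cong_iff_dvd_diff)
qed

lemma lucas_period_pow2:
  assumes "lucas_period A B q 2"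
  shows "lucas_period A B (2 ^ k * q) (2 ^ Suc k)"
proof (induction k)
  case 0
  then show ?case using assms by simp
next
  case (Suc k)
  then show ?case using lucas_period_double[OF Suc] by (simp add: mult.assoc)
qed

text \<open>Modulo 2 the sequence has period 2 for even \<open>A\<close> and 3 for odd
  \<open>A\<close>; \<open>\<pi>\<close> is twice that.\<close>

lemma lucas_period_2:
  assumes "odd B" "\<pi> = (if even A then 4 else 6)"
  shows "lucas_period A B \<pi> 2"
proof -
  have "lucas_period A B 2 2" if "even A"
    using that assms by (auto simp: lucas_period_def numeral_2_eq_2 cong_iff_dvd_diff)
  moreover have "lucas_period A B 3 2" if "odd A"
    using that assms by (auto simp: lucas_period_def numeral_3_eq_3 cong_iff_dvd_diff)
  ultimately show ?thesis using lucas_period_mult[of A B 2 2 2] lucas_period_mult[of A B 3 2 2] assms(2)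
    by (auto split: if_splits)
qed

text \<open>Modulo 2 the sequence repeats 0, 1, 1. This will force a factor 3 into every index with
  an even term, matching \<open>\<pi> = 6\<close>.\<close>

lemma lucas_odd:
  assumes "odd A" "odd B" "\<not> 3 dvd n"
  shows "odd (lucas_u A B n)"
proof -
  have "lucas_period A B 3 2"
    using assms by (auto simp: lucas_period_def numeral_3_eq_3 cong_iff_dvd_diff)
  from lucas_period_add_mult[OF this, of "n mod 3" "n div 3"]
  have "[lucas_u A B n = lucas_u A B (n mod 3)] (mod 2)" by simp
  moreover have "n mod 3 = 1 \<or> n mod 3 = Suc 1" using assms(3) by presburger
  ultimately have "[lucas_u A B n = 1] (mod 2) \<or> [lucas_u A B n = A] (mod 2)" by auto
  then show ?thesis using assms(1) by (simp only: cong_def) presburger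
qed

text \<open>Moving the index by \<open>q\<close> raises the cofactor by 1 modulo \<open>m\<close>.
  The cofactor is a witness rather than a quotient because \<open>lucas_u A B q\<close> may be
  0.\<close>

lemma lucas_u_mult_linear:
  assumes "lucas_period A B q m"
  shows "\<exists>w. lucas_u A B (l * q) = lucas_u A B q * w \<and> [w = int l] (mod m)"
proof (induction l)
  case (Suc l)
  then obtain w where w: "lucas_u A B (l * q) = lucas_u A B q * w" "[w = int l] (mod m)" by blast
  \<comment> \<open>The cofactor read off from \<open>lucas_u_shift\<close>. Since \<open>q\<close>
    and \<open>l * q\<close> are periods, it is \<open>w + 1\<close> modulo
    \<open>m\<close>.\<close>
  define w' where "w' = w * lucas_u A B (Suc q) + (lucas_u A B (Suc (l * q)) - A * lucas_u A B (l * q))"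
  have "lucas_u A B (Suc l * q) = lucas_u A B q * w'"
    using lucas_u_shift[of A B "l * q" q] w(1) by (simp add: algebra_simps w'_def)
  moreover have "[w' = int l * 1 + (1 - A * 0)] (mod m)"
    unfolding w'_def using w(2) assms lucas_period_mult[OF assms, of l] unfolding lucas_period_def
    by (intro cong_add cong_mult cong_diff cong_refl) auto
  ultimately show ?case by (auto simp: algebra_simps)
qed (auto intro: exI[of _ 0])

text \<open>Modulo 1 every \<open>q\<close> is a period, so the factorization just shown is
  available unconditionally.\<close>

lemma lucas_u_dvd: "lucas_u A B q dvd lucas_u A B (l * q)"
  using lucas_u_mult_linear[of A B q 1 l] by (auto simp: lucas_period_def)

text \<open>Each doubling of the index multiplies by \<open>2 u\<^sub>n\<^sub>+\<^sub>1 - A u\<^sub>n\<close>, which is \<open>2\<close> modulo \<open>16\<close>.\<close>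

lemma lucas_u_pow2_linear:
  assumes "lucas_period A B q 16"
  shows "\<exists>w. lucas_u A B (2 ^ s * l * q) = lucas_u A B q * 2 ^ s * w \<and> [w = int l] (mod 8)"
proof (induction s)
  case 0
  obtain w where "lucas_u A B (l * q) = lucas_u A B q * w" "[w = int l] (mod 16)"
    using lucas_u_mult_linear[OF assms] by blast
  moreover from this have "[w = int l] (mod 8)" using cong_dvd_modulus[of _ _ 16 "8::int"] by simp
  ultimately show ?case by auto
next
  case (Suc s)
  then obtain w where w: "lucas_u A B (2 ^ s * l * q) = lucas_u A B q * 2 ^ s * w" "[w = int l] (mod 8)"
    by blast
  define n where "n = 2 ^ s * l * q"
  have "lucas_period A B n 16" using lucas_period_mult[OF assms] by (simp add: n_def)
  then have "[2 * lucas_u A B (Suc n) - A * lucas_u A B n = 2 * 1 - A * 0] (mod 16)"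
    unfolding lucas_period_def by (intro cong_diff cong_mult cong_refl) auto
  then obtain x where x: "2 * lucas_u A B (Suc n) - A * lucas_u A B n = 2 + 16 * x"
    by (auto simp: cong_iff_dvd_diff dvd_def algebra_simps)
  have "lucas_u A B (2 ^ Suc s * l * q) = lucas_u A B n * (2 + 16 * x)"
    using lucas_u_double[of A B n] x by (simp add: n_def mult.assoc)
  \<comment> \<open>The 2 joins the power of two, and the remaining \<open>1 + 8 * x\<close> leaves
    \<open>w\<close> unchanged modulo 8; hence the moduli 16 and 8.\<close>
  also have "\<dots> = lucas_u A B q * 2 ^ Suc s * (w * (1 + 8 * x))"
    using w(1) by (simp add: n_def algebra_simps)
  finally have "lucas_u A B (2 ^ Suc s * l * q) = lucas_u A B q * 2 ^ Suc s * (w * (1 + 8 * x))" .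
  moreover have "[w * (1 + 8 * x) = int l] (mod 8)"
    using w(2) by (simp add: cong_iff_dvd_diff distrib_left)
      (metis dvd_add dvd_triv_left mult.left_commute add_diff_eq diff_add_eq)
  ultimately show ?case by blast
qed

text \<open>By Binet's formula a zero term would make \<open>\<alpha> / \<beta>\<close> an
  \<open>n\<close>-th root of unity. The formula is kept multiplied by
  \<open>\<alpha> - \<beta>\<close>, so a double root needs no separate case.\<close>

lemma lucas_u_nonzero:
  assumes "nondegenerate A B" "B \<noteq> 0" "n > 0"
  shows "lucas_u A B n \<noteq> 0"
proof
  assume 0: "lucas_u A B n = 0"
  define D where "D = csqrt (of_int (A\<^sup>2 + 4 * B))"
  define \<alpha> \<beta> where "\<alpha> = (of_int A + D) / 2" and "\<beta> = (of_int A - D) / 2"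
  have D2: "D * D = of_int (A\<^sup>2 + 4 * B)" by (metis D_def power2_csqrt power2_eq_square)
  have s: "\<alpha> + \<beta> = of_int A" by (simp add: \<alpha>_def \<beta>_def field_simps)
  have p: "\<alpha> * \<beta> = - of_int B" using D2 by (simp add: \<alpha>_def \<beta>_def field_simps power2_eq_square)
  have "[:- of_int B, - of_int A, 1:] = [:- \<alpha>, 1:] * [:- \<beta>, 1:]"
    using s p by (simp add: algebra_simps flip: s)
  then have nr: "\<not> root_of_unity (\<alpha> / \<beta>)" using assms(1) unfolding nondegenerate_def by blast
  have *: "(\<alpha> - \<beta>) * of_int (lucas_u A B k) = \<alpha> ^ k - \<beta> ^ k" for k
  proof (induction k rule: induct_nat_012)
    case (ge2 k)
    have "(\<alpha> - \<beta>) * of_int (lucas_u A B (Suc (Suc k))) = of_int A * ((\<alpha> - \<beta>) * of_int (lucas_u A B (Suc k)))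
       + of_int B * ((\<alpha> - \<beta>) * of_int (lucas_u A B k))" by (simp add: algebra_simps)
    also have "\<dots> = (\<alpha> + \<beta>) * (\<alpha> ^ Suc k - \<beta> ^ Suc k) - \<alpha> * \<beta> * (\<alpha> ^ k - \<beta> ^ k)"
      using ge2 by (simp add: s p)
    also have "\<dots> = \<alpha> ^ Suc (Suc k) - \<beta> ^ Suc (Suc k)" by (simp add: algebra_simps)
    finally show ?case .
  qed auto
  have "\<beta> \<noteq> 0" using p assms(2) by auto
  moreover have "\<alpha> ^ n = \<beta> ^ n" using *[of n] 0 by simp
  ultimately have "(\<alpha> / \<beta>) ^ n = 1" by (simp add: power_divide)
  then show False using nr assms(3) unfolding root_of_unity_def by blast
qed

section \<open>Numbers of the form 4^a (8 b + 7)\<close>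

definition legendre_form :: "int \<Rightarrow> bool" where
  "legendre_form m \<longleftrightarrow> (\<exists>a b :: nat. m = 4 ^ a * (8 * int b + 7))"

text \<open>Both \<open>h\<close> and \<open>8 b + 7\<close> are odd, so comparing powers of two
  gives \<open>e = 2 * a\<close>. Positivity of \<open>h\<close> makes \<open>h div 8\<close> an
  admissible natural number \<open>b\<close>.\<close>

lemma legendre_form_iff:
  assumes "odd h" "h > 0"
  shows "legendre_form (2 ^ e * h) \<longleftrightarrow> even e \<and> [h = 7] (mod 8)"
proof
  assume "even e \<and> [h = 7] (mod 8)"
  moreover from this obtain a where "e = 2 * a" by auto
  moreover have "h = 8 * (h div 8) + 7" "h div 8 \<ge> 0"
    using calculation assms by (simp_all add: cong_def) presburger
  ultimately show "legendre_form (2 ^ e * h)"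
    unfolding legendre_form_def by (intro exI[of _ a] exI[of _ "nat (h div 8)"]) (simp add: power_mult)
next
  assume "legendre_form (2 ^ e * h)"
  then obtain a b where ab: "2 ^ e * h = 4 ^ a * (8 * int b + 7)" by (auto simp: legendre_form_def)
  then have eq: "2 ^ e * h = 2 ^ (2 * a) * (8 * int b + 7)" by (simp add: power_mult)
  have "e = 2 * a"
  proof (cases e "2 * a" rule: linorder_cases)
    case less
    then obtain d where "2 * a = e + Suc d" by (auto simp: less_iff_Suc_add)
    then have "h = 2 * (2 ^ d * (8 * int b + 7))" using eq by (simp add: power_add)
    then show ?thesis using assms by (metis dvd_triv_left)
  next
    case greater
    then obtain d where "e = 2 * a + Suc d" by (auto simp: less_iff_Suc_add)
    then have "2 * (2 ^ d * h) = 8 * int b + 7" using eq by (simp add: power_add)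
    then show ?thesis by presburger
  qed
  then show "even e \<and> [h = 7] (mod 8)" using eq by (simp add: cong_def)
qed

text \<open>Since \<open>2 ^ K\<close> does not divide \<open>m\<close>, the factor
  \<open>4 ^ a\<close> has \<open>2 * a < K\<close>, so a change by a multiple of
  \<open>2 ^ (K + 3)\<close> alters the odd part only by a multiple of 8. Positivity of
  \<open>m'\<close> keeps the new \<open>b\<close> nonnegative.\<close>

lemma legendre_form_cong:
  assumes "legendre_form m" "[m = m'] (mod 2 ^ (K + 3))" "\<not> 2 ^ K dvd m" "m' > 0"
  shows "legendre_form m'"
proof -
  obtain a b where m: "m = 4 ^ a * (8 * int b + 7)" using assms(1) by (auto simp: legendre_form_def)
  obtain x where x: "m' = m + 2 ^ (K + 3) * x"
    using assms(2) cong_sym[OF assms(2)] by (auto simp: cong_iff_dvd_diff dvd_def algebra_simps)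
  have p4: "(4::int) ^ a = 2 ^ (2 * a)" by (simp add: power_mult)
  then have "2 * a < K"
    using assms(3) m by (metis dvd_mult2 le_imp_power_dvd not_less)
  then obtain d where d: "K = 2 * a + d" by (auto simp: less_iff_Suc_add)
  have m': "m' = 4 ^ a * (8 * (int b + 2 ^ d * x) + 7)"
    unfolding x m d by (simp add: power_add p4 distrib_left mult_ac)
  then have "8 * (int b + 2 ^ d * x) + 7 > 0" using assms(4) by (simp add: zero_less_mult_iff)
  then have "int b + 2 ^ d * x \<ge> 0" by presburger
  then show ?thesis unfolding legendre_form_def m' by (intro exI[of _ a] exI[of _ "nat (int b + 2 ^ d * x)"]) simp
qed

lemma nat_two_power_odd:
  assumes "(n::nat) > 0"
  obtains s l where "n = 2 ^ s * l" "odd l"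
proof (rule multiplicity_decompose'[of n "2::nat"])
  fix y assume "n = 2 ^ multiplicity 2 n * y" "odd y"
  then show thesis by (rule that)
qed (use assms in auto)

section \<open>Indices of Lucas terms of the form 4^a (8 b + 7)\<close>

lemma lucas_legendre_form_set:
  assumes B: "odd B" and nd: "nondegenerate A B" and nonneg: "\<And>n. lucas_u A B n \<ge> 0"
    and \<pi>: "\<pi> = (if even A then 4 else 6)"
  shows "\<exists>\<S> :: nat set set. finite \<S> \<and>
    (\<forall>S\<in>\<S>.
        (\<exists>t j :: nat. j \<in> {1..2 ^ t * \<pi> - 1} \<and> S = {2 ^ t * \<pi> * l + j | l. l \<in> (UNIV :: nat set)})
      \<or> (\<exists>t c :: nat. c \<in> {0..7} \<and>
            S = {2 ^ (t + 2 * k) * \<pi> * (8 * l + c) | k l. k \<in> (UNIV :: nat set) \<and> l \<in> (UNIV :: nat set)})) \<and>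
    {n. legendre_form (lucas_u A B n)} = \<Union>\<S>"
proof -
  have pos: "lucas_u A B n > 0" if "n > 0" for n
    using lucas_u_nonzero[OF nd _ that] B nonneg[of n] by (metis dvd_0_right le_less)
  have per: "lucas_period A B (2 ^ k * \<pi>) (2 ^ Suc k)" for k
    by (rule lucas_period_pow2[OF lucas_period_2[OF B \<pi>]])
  have \<pi>0: "\<pi> > 0" using \<pi> by simp
  define q where "q = 2 ^ 3 * \<pi>"
  have q0: "q > 0" by (simp add: q_def \<pi>0)
  have per16: "lucas_period A B q 16" using per[of 3] by (simp add: q_def)
  obtain e h0 where eh0: "nat (lucas_u A B q) = 2 ^ e * h0" "odd h0"
    using nat_two_power_odd pos[OF q0] by (metis zero_less_nat_eq)
  define h where "h = int h0"
  have h: "lucas_u A B q = 2 ^ e * h" "odd h"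
    using eh0 pos[OF q0] unfolding h_def by (metis int_nat_eq less_le of_nat_mult of_nat_numeral of_nat_power, simp)
  have h0: "h > 0" using pos[OF q0] h by (simp add: zero_less_mult_iff)
  have mult: "\<exists>w. lucas_u A B (2 ^ s * l * q) = 2 ^ (e + s) * (h * w) \<and> odd (h * w) \<and> h * w > 0 \<and> [w = int l] (mod 8)"
    if l: "odd l" for s l
  proof -
    obtain w where w: "lucas_u A B (2 ^ s * l * q) = lucas_u A B q * 2 ^ s * w" "[w = int l] (mod 8)"
      using lucas_u_pow2_linear[OF per16] by blast
    have eq: "lucas_u A B (2 ^ s * l * q) = 2 ^ (e + s) * (h * w)" using w(1) h by (simp add: power_add)
    have "odd w" using w(2) l by (metis cong_dvd_iff cong_dvd_modulus even_numeral even_of_nat)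
    moreover have "2 ^ s * l * q > 0" using l q0 by (simp add: odd_pos)
    ultimately show ?thesis using eq w(2) h pos[of "2 ^ s * l * q"] by (auto simp: zero_less_mult_iff)
  qed
  \<comment> \<open>As \<open>h * h\<close> is 1 modulo 8, the product \<open>h * l\<close> is 7
    modulo 8 exactly when \<open>l\<close> is \<open>7 * h\<close> modulo 8.\<close>
  define c where "c = nat (7 * h mod 8)"
  have c8: "int c = 7 * h mod 8" "c \<in> {0..7}" unfolding c_def using pos_mod_bound[of 8 "7 * h"] by auto
  have multiples: "legendre_form (lucas_u A B (2 ^ s * l * q)) \<longleftrightarrow> even (e + s) \<and> [l = c] (mod 8)"
    if l: "odd l" for s l
  proof -
    obtain w where w: "lucas_u A B (2 ^ s * l * q) = 2 ^ (e + s) * (h * w)" "odd (h * w)" "h * w > 0" "[w = int l] (mod 8)"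
      using mult[OF l] by blast
    have "[h * h = 1] (mod 8)"
    proof -
      have "h mod 8 = 1 \<or> h mod 8 = 3 \<or> h mod 8 = 5 \<or> h mod 8 = 7" using h(2) by presburger
      then have "(h mod 8) * (h mod 8) mod 8 = 1" by auto
      then show ?thesis by (simp add: cong_def mod_mult_eq)
    qed
    moreover have "[h * w = h * int l] (mod 8)" using w(4) by (intro cong_mult cong_refl)
    ultimately have "[h * w = 7] (mod 8) \<longleftrightarrow> [int l = 7 * h] (mod 8)"
    proof -
      assume hh: "[h * h = 1] (mod 8)" and hw: "[h * w = h * int l] (mod 8)"
      have "[h * int l = 7] (mod 8) \<longleftrightarrow> [int l = 7 * h] (mod 8)"
      proof
        assume "[h * int l = 7] (mod 8)"
        then have "[h * (h * int l) = h * 7] (mod 8)" by (intro cong_mult cong_refl)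
        moreover have "[(h * h) * int l = 1 * int l] (mod 8)" using hh by (intro cong_mult cong_refl)
        ultimately show "[int l = 7 * h] (mod 8)" by (simp add: cong_def mult_ac)
      next
        assume "[int l = 7 * h] (mod 8)"
        then have "[h * int l = h * (7 * h)] (mod 8)" by (intro cong_mult cong_refl)
        moreover have "[(h * h) * 7 = 1 * 7] (mod 8)" using hh by (intro cong_mult cong_refl)
        ultimately show "[h * int l = 7] (mod 8)" by (simp add: cong_def mult_ac)
      qed
      then show ?thesis using hw by (simp add: cong_def)
    qed
    also have "\<dots> \<longleftrightarrow> [l = c] (mod 8)" 
      unfolding cong_int_iff[symmetric] c8(1) by (simp add: cong_def)
    finally show ?thesis using legendre_form_iff[OF w(2,3), of "e + s"] w(1) by simp
  qed
  \<comment> \<open>For \<open>n = 2 ^ s * l\<close> with odd \<open>l\<close>, the term at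
    \<open>n\<close> divides the one at \<open>q * n\<close>, whose 2-adic valuation is
    \<open>e + s\<close>. If \<open>q\<close> does not divide \<open>n\<close> and the term is even,
    then \<open>s \<le> 4\<close>, so the valuation stays below \<open>e + 5\<close>.\<close>
  define K where "K = e + 5"
  have ndvd: "\<not> 2 ^ K dvd lucas_u A B n" if n: "\<not> q dvd n" for n
  proof
    assume d: "2 ^ K dvd lucas_u A B n"
    have n0: "n > 0" using n by (cases n) auto
    obtain s l where sl: "n = 2 ^ s * l" "odd l" using nat_two_power_odd[OF n0] by blast
    have "even (lucas_u A B n)" using d by (rule dvd_trans[rotated]) (simp add: K_def)
    then have 3: "odd A \<Longrightarrow> 3 dvd l"
    proof -
      assume "odd A"
      then have "3 dvd 2 ^ s * l" using lucas_odd[of A B n] B \<open>even (lucas_u A B n)\<close> sl(1) by blast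
      moreover have "coprime 3 ((2::nat) ^ s)" by simp
      ultimately show ?thesis by (simp add: coprime_dvd_mult_right_iff)
    qed
    \<comment> \<open>\<open>q\<close> is 32 for even \<open>A\<close> and 48 for odd
      \<open>A\<close>; in the latter case the factor 3 of \<open>l\<close> is already
      known.\<close>
    have "s \<le> 4"
    proof (rule ccontr)
      assume "\<not> s \<le> 4"
      then have "(2::nat) ^ 5 dvd 2 ^ s" by (intro le_imp_power_dvd) simp
      then have "2 ^ 5 dvd n" using sl by simp
      moreover have "odd A \<Longrightarrow> 2 ^ 4 * 3 dvd n" unfolding sl
        using \<open>2 ^ 5 dvd 2 ^ s\<close> by (intro mult_dvd_mono 3) (auto intro: dvd_trans[rotated])
      ultimately show False using n by (auto simp: q_def \<pi> split: if_splits)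
    qed
    obtain w where w: "lucas_u A B (2 ^ s * l * q) = 2 ^ (e + s) * (h * w)" "odd (h * w)"
      using mult[OF sl(2)] by blast
    have "lucas_u A B n dvd lucas_u A B (q * n)" by (rule lucas_u_dvd)
    then have "2 ^ K dvd 2 ^ (e + s) * (h * w)" using d w(1) sl(1) by (metis dvd_trans mult.commute)
    moreover have "(2::int) ^ (e + Suc s) dvd 2 ^ K" using \<open>s \<le> 4\<close> by (intro le_imp_power_dvd) (simp add: K_def)
    ultimately have "2 ^ (e + s) * 2 dvd 2 ^ (e + s) * (h * w)" by (metis dvd_trans add_Suc_right power_Suc2)
    then show False using w(2) by simp
  qed
  \<comment> \<open>A multiple of \<open>q\<close> that is a period modulo
    \<open>2 ^ (K + 3)\<close>, the modulus demanded by \<open>legendre_form_cong\<close>.\<close>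
  define Q where "Q = 2 ^ (K + 2) * \<pi>"
  have Q0: "Q > 0" by (simp add: Q_def \<pi>0)
  have perQ: "lucas_period A B Q (2 ^ (K + 3))" using per[of "K + 2"] by (simp add: Q_def numeral_3_eq_3)
  have qQ: "q dvd Q" unfolding q_def Q_def by (intro mult_dvd_mono le_imp_power_dvd) (auto simp: K_def)
  have nonmult: "legendre_form (lucas_u A B (j + l * Q)) \<longleftrightarrow> legendre_form (lucas_u A B j)"
    if j: "\<not> q dvd j" for j l
  proof -
    have c: "[lucas_u A B (j + l * Q) = lucas_u A B j] (mod 2 ^ (K + 3))"
      by (rule lucas_period_add_mult[OF perQ])
    have j': "\<not> q dvd j + l * Q" using j qQ by (simp add: dvd_add_left_iff)
    have "j > 0" using j by (cases j) auto
    then show ?thesis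
      using legendre_form_cong[OF _ c ndvd[OF j']] legendre_form_cong[OF _ cong_sym[OF c] ndvd[OF j]] pos by auto
  qed
  define J where "J = {j. j < Q \<and> \<not> q dvd j \<and> legendre_form (lucas_u A B j)}"
  define P where "P j = {Q * l + j | l. l \<in> (UNIV :: nat set)}" for j
  \<comment> \<open>The 3 comes from \<open>q = 2 ^ 3 * \<pi>\<close>; the remaining exponent
    \<open>s\<close> must have the parity of \<open>e\<close>.\<close>
  define t where "t = 3 + e mod 2"
  define M where "M = {2 ^ (t + 2 * k) * \<pi> * (8 * l + c) | k l. k \<in> (UNIV :: nat set) \<and> l \<in> (UNIV :: nat set)}"
  \<comment> \<open>With \<open>c\<close> odd, \<open>8 * l + c\<close> is odd, so
    \<open>multiples\<close> applies to every element of \<open>M\<close>.\<close>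
  have oddc: "odd c"
  proof -
    have "odd (7 * h mod 8)" using h(2) by presburger
    then show ?thesis using c8(1) by (metis even_of_nat)
  qed
  have "{n. legendre_form (lucas_u A B n)} = \<Union> (insert M (P ` J))"
  proof (intro equalityI subsetI)
    fix n assume "n \<in> {n. legendre_form (lucas_u A B n)}"
    then have n: "legendre_form (lucas_u A B n)" by simp
    have "\<not> legendre_form 0" by (auto simp: legendre_form_def)
    then have n0: "n > 0" using n by (cases n) auto
    show "n \<in> \<Union> (insert M (P ` J))"
    proof (cases "q dvd n")
      case True
      then obtain r where r: "n = q * r" by auto
      then have "r > 0" using n0 by (cases r) auto
      then obtain s l where sl: "r = 2 ^ s * l" "odd l" using nat_two_power_odd by blast
      have nn: "n = 2 ^ s * l * q" using r sl by simp
      then have es: "even (e + s)" "[l = c] (mod 8)" using n multiples[OF sl(2)] by auto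
      define k where "k = s div 2"
      have s: "3 + s = t + 2 * k" unfolding t_def k_def using es(1) by presburger
      have l: "l = 8 * (l div 8) + c" using es(2) c8(2) by (simp add: cong_def) presburger
      have "n = 2 ^ (3 + s) * \<pi> * l" by (simp add: nn q_def power_add)
      then have "n = 2 ^ (t + 2 * k) * \<pi> * (8 * (l div 8) + c)" using s l by metis
      then have "n \<in> M" unfolding M_def by blast
      then show ?thesis by blast
    next
      case False
      have eq: "n = n mod Q + (n div Q) * Q" by simp
      have "\<not> q dvd n mod Q" using False qQ by (simp add: dvd_mod_iff)
      moreover have "legendre_form (lucas_u A B (n mod Q))" using nonmult[OF calculation, of "n div Q"] n eq by simp
      ultimately have "n mod Q \<in> J" using Q0 by (simp add: J_def)
      moreover have "n \<in> P (n mod Q)" unfolding P_def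
        by (intro CollectI exI[of _ "n div Q"] conjI) simp_all
      ultimately show ?thesis by blast
    qed
  next
    fix n assume "n \<in> \<Union> (insert M (P ` J))"
    then consider "n \<in> M" | j where "j \<in> J" "n \<in> P j" by blast
    then show "n \<in> {n. legendre_form (lucas_u A B n)}"
    proof cases
      case 1
      then obtain k l where n: "n = 2 ^ (t + 2 * k) * \<pi> * (8 * l + c)" unfolding M_def by blast
      define s where "s = e mod 2 + 2 * k"
      have "n = 2 ^ s * (8 * l + c) * q" unfolding n q_def s_def t_def by (simp add: power_add)
      moreover have "odd (8 * l + c)" using oddc by simp
      moreover have "even (e + s)" unfolding s_def by presburger
      moreover have "[8 * l + c = c] (mod 8)" by (simp add: cong_def)
      ultimately show ?thesis using multiples[of "8 * l + c" s] by simp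
    next
      case 2
      then show ?thesis using nonmult[of j] by (auto simp: P_def J_def add.commute mult.commute)
    qed
  qed
  moreover have "finite (insert M (P ` J))" by (simp add: J_def)
  moreover have "\<exists>t j :: nat. j \<in> {1..2 ^ t * \<pi> - 1} \<and> P i = {2 ^ t * \<pi> * l + j | l. l \<in> (UNIV :: nat set)}"
    if "i \<in> J" for i
  proof (intro exI conjI)
    \<comment> \<open>Index 0 is a multiple of \<open>q\<close>, hence not in \<open>J\<close>; this
      gives the lower bound 1 for the residue.\<close>
    have "i \<noteq> 0" using that by (auto simp: J_def intro!: Nat.gr0I)
    then show "i \<in> {1..2 ^ (K + 2) * \<pi> - 1}" using that by (auto simp: J_def Q_def)
    show "P i = {2 ^ (K + 2) * \<pi> * l + i | l. l \<in> UNIV}" by (simp add: P_def Q_def)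
  qed
  moreover have "\<exists>t c :: nat. c \<in> {0..7} \<and>
      M = {2 ^ (t + 2 * k) * \<pi> * (8 * l + c) | k l. k \<in> (UNIV :: nat set) \<and> l \<in> (UNIV :: nat set)}"
    using c8(2) M_def by blast
  ultimately show ?thesis by (intro exI[of _ "insert M (P ` J)"]) blast
qed

section \<open>Ternary forms of determinant one\<close>

text \<open>The form of the symmetric integer matrix with rows (a, f, e), (f, b, d), (e, d, c);
  \<open>tdet\<close> is the determinant of this matrix.\<close>

definition tform :: "int \<Rightarrow> int \<Rightarrow> int \<Rightarrow> int \<Rightarrow> int \<Rightarrow> int \<Rightarrow> int \<Rightarrow> int \<Rightarrow> int \<Rightarrow> int" where
  "tform a b c d e f x y z = a*x\<^sup>2 + b*y\<^sup>2 + c*z\<^sup>2 + 2*d*y*z + 2*e*x*z + 2*f*x*y"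

definition tdet :: "int \<Rightarrow> int \<Rightarrow> int \<Rightarrow> int \<Rightarrow> int \<Rightarrow> int \<Rightarrow> int" where
  "tdet a b c d e f = a*b*c + 2*d*e*f - a*d\<^sup>2 - b*e\<^sup>2 - c*f\<^sup>2"

lemma abs_le_half_shift:
  fixes a f :: int
  assumes "a > 0"
  obtains k where "2 * \<bar>f + k * a\<bar> \<le> a"
proof -
  define r where "r = (2 * f + a) mod (2 * a)"
  define m where "m = (2 * f + a) div (2 * a)"
  have "2 * f + a = 2 * a * m + r" by (simp add: m_def r_def)
  moreover have "0 \<le> r" "r < 2 * a" using assms by (simp_all add: r_def)
  ultimately have "2 * \<bar>f + (- m) * a\<bar> \<le> a" by (auto simp: abs_if algebra_simps)
  then show thesis by (rule that)
qed

text \<open>Here \<open>(A, B, C)\<close> is the binary form left over when \<open>a\<close> times the ternary form is written as a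
  square plus a form in two variables; a determinant-one ternary form gives it determinant \<open>a\<close>.\<close>

lemma reduced_first_coeff:
  fixes a b f A B C :: int
  assumes "a > 0" "A > 0" "A = a * b - f\<^sup>2" "A * C - B\<^sup>2 = a" "2 * \<bar>f\<bar> \<le> a" "2 * \<bar>B\<bar> \<le> A" "A \<le> C" "a \<le> b"
  shows "a = 1"
proof -
  have sq: "4 * x\<^sup>2 \<le> y\<^sup>2" if "2 * \<bar>x\<bar> \<le> y" for x y :: int
  proof -
    have "(2 * \<bar>x\<bar>)\<^sup>2 \<le> y\<^sup>2" using that by (intro power_mono) auto
    then show ?thesis by (simp add: power_mult_distrib)
  qed
  have "4 * B\<^sup>2 \<le> A\<^sup>2" "4 * f\<^sup>2 \<le> a\<^sup>2" using assms sq by blast+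
  have "A\<^sup>2 \<le> A * C" using assms by (simp add: power2_eq_square)
  then have 1: "3 * A\<^sup>2 \<le> 4 * a" using assms(4) \<open>4 * B\<^sup>2 \<le> A\<^sup>2\<close> by linarith
  have "a\<^sup>2 \<le> a * b" using assms by (simp add: power2_eq_square)
  then have 2: "3 * a\<^sup>2 \<le> 4 * A" using assms(3) \<open>4 * f\<^sup>2 \<le> a\<^sup>2\<close> by linarith
  \<comment> \<open>For \<open>a \<ge> 2\<close> the inequality for the larger of \<open>a\<close>
    and \<open>A\<close> fails, since its square is at least twice that number.\<close>
  show ?thesis
  proof (rule ccontr)
    assume "a \<noteq> 1"
    then have a2: "a \<ge> 2" using assms(1) by simp
    show False
    proof (cases "a \<le> A")
      case True
      have "A * A \<ge> 2 * A" using True a2 by (intro mult_right_mono) auto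
      then show ?thesis using 1 True a2 unfolding power2_eq_square by linarith
    next
      case False
      have "a * a \<ge> 2 * a" using a2 by (intro mult_right_mono) auto
      then show ?thesis using 2 False a2 unfolding power2_eq_square by linarith
    qed
  qed
qed

text \<open>Lexicographic descent on the first two leading minors. Shifting \<open>x\<close> by a
  multiple of \<open>y\<close> and swapping the two may lower the first minor; shifting
  \<open>y\<close> by a multiple of \<open>z\<close> and swapping these may lower the second and
  keeps the first. If neither helps, the form is reduced and both minors are 1.\<close>

lemma tform_sum_of_three_squares:
  assumes "a > 0" "a * b - f\<^sup>2 > 0" "tdet a b c d e f = 1"
  shows "sum_of_three_squares (tform a b c d e f x y z)"
  using assms
proof (induction "(nat a, nat (a * b - f\<^sup>2))" arbitrary: a b c d e f x y z rule: wf_induct_rule[OF wf_lex_prod[OF wf_less_than wf_less_than]])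
  case (1 a b f c d e x y z)
  define A B C where "A = a * b - f\<^sup>2" and "B = a * d - e * f" and "C = a * c - e\<^sup>2"
  have det: "A * C - B\<^sup>2 = a * tdet a b c d e f"
    by (simp add: A_def B_def C_def tdet_def algebra_simps power2_eq_square)
  then have det1: "A * C - B\<^sup>2 = a" using 1 by simp
  have A: "A > 0" using 1 by (simp add: A_def)
  have IH: "sum_of_three_squares (tform a b c d e f x y z)"
    if "a' > 0" "a' * b' - f'\<^sup>2 > 0" "tdet a' b' c' d' e' f' = tdet a b c d e f"
       "a' < a \<or> (a' = a \<and> a' * b' - f'\<^sup>2 < A)" "tform a b c d e f x y z = tform a' b' c' d' e' f' x' y' z'"
    for a' b' c' d' e' f' x' y' z'
    unfolding that(5) using that 1 by (intro 1(1)) (auto simp: A_def)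
  obtain k where k: "2 * \<bar>f + k * a\<bar> \<le> a" using abs_le_half_shift 1 by blast
  \<comment> \<open>\<open>k\<close> reduces the cross coefficient \<open>f\<close> of the ternary
    form, \<open>j\<close> the middle coefficient \<open>B\<close> of the binary form (A, B,
    C).\<close>
  obtain j where j: "2 * \<bar>B + j * A\<bar> \<le> A" using abs_le_half_shift A by blast
  define b1 f1 where "b1 = b + 2 * k * f + k\<^sup>2 * a" and "f1 = f + k * a"
  define c1 d1 e1 where "c1 = c + 2 * j * d + j\<^sup>2 * b" and "d1 = d + j * b" and "e1 = e + j * f"
  define B1 C1 where "B1 = B + j * A" and "C1 = a * c1 - e1\<^sup>2"
  have A1: "a * b1 - f1\<^sup>2 = A" by (simp add: A_def b1_def f1_def algebra_simps power2_eq_square)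
  have B1: "B1 = a * d1 - e1 * f" by (simp add: A_def B_def B1_def d1_def e1_def algebra_simps power2_eq_square)
  have C1: "C1 = C + 2 * j * B + j\<^sup>2 * A" 
    by (simp add: A_def B_def C_def C1_def c1_def e1_def algebra_simps power2_eq_square)
  have det2: "A * C1 - B1\<^sup>2 = a" unfolding C1 B1_def using det1 by (simp add: algebra_simps power2_eq_square)
  have C1pos: "C1 > 0"
  proof -
    have "A * C1 > 0" using det2 1 by (smt (verit) zero_le_power2)
    then show ?thesis using A by (simp add: zero_less_mult_iff)
  qed
  consider "b1 < a" | "C1 < A" | "a \<le> b1" "A \<le> C1" by linarith
  then show ?case
  proof cases
    case 1
    have "a * b1 > 0" using A A1 by (smt (verit) zero_le_power2)
    then have "b1 > 0" using \<open>0 < a\<close> by (simp add: zero_less_mult_iff)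
    then show ?thesis
      using 1 A A1
      by (intro IH[of b1 a f1 c e "d + k * e" "y" "x - k * y" z])
        (simp_all add: mult.commute tform_def tdet_def b1_def f1_def algebra_simps power2_eq_square)
  next
    case 2
    then show ?thesis
      using C1pos \<open>0 < a\<close>
      by (intro IH[of a c1 e1 b d1 f x "z" "y - j * z"])
        (simp_all add: C1_def tform_def tdet_def c1_def d1_def e1_def algebra_simps power2_eq_square)
  next
    case 3
    have a1: "a = 1"
      by (rule reduced_first_coeff[of a A b1 f1 C1 B1])
        (use 3 A A1 det2 k j \<open>0 < a\<close> in \<open>auto simp: f1_def B1_def\<close>)
    have "3 * A\<^sup>2 \<le> 4"
    proof -
      have "4 * B1\<^sup>2 \<le> A\<^sup>2" using power_mono[OF j, of 2] by (simp add: B1_def power_mult_distrib)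
      moreover have "A\<^sup>2 \<le> A * C1" using 3 A by (simp add: power2_eq_square)
      ultimately show ?thesis using det2 a1 by linarith
    qed
    then have "A\<^sup>2 < 2\<^sup>2" by simp
    then have "A < 2" by (rule power_less_imp_less_base) simp
    then have "A = 1" using A by simp
    then have B10: "B1 = 0" using j unfolding B1_def by (simp, arith)
    then have C11: "C1 = 1" using det2 a1 \<open>A = 1\<close> by simp
    have "B = - j" using B10 \<open>A = 1\<close> by (simp add: B1_def)
    then have C: "C = 1 + j\<^sup>2" using C11 C1 \<open>A = 1\<close> by (simp add: power2_eq_square)
    \<comment> \<open>With \<open>a = 1\<close> the minors determine \<open>b\<close>,
      \<open>c\<close> and \<open>d\<close> from \<open>e\<close>, \<open>f\<close> and
      \<open>j\<close>, and completing squares leaves three integral linear forms.\<close>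
    have b: "b = 1 + f\<^sup>2" and d: "d = e * f - j" and c: "c = 1 + j\<^sup>2 + e\<^sup>2"
      using a1 \<open>A = 1\<close> \<open>B = - j\<close> C by (simp_all add: A_def B_def C_def)
    have "tform a b c d e f x y z = (x + f * y + e * z)\<^sup>2 + (y - j * z)\<^sup>2 + z\<^sup>2"
      by (simp add: tform_def a1 b c d algebra_simps power2_eq_square)
    then show ?thesis unfolding sum_of_three_squares_def by blast
  qed
qed

text \<open>The two congruences are what is needed to build an integral ternary form of determinant one with
  first coefficient \<open>n\<close>, whose associated binary form is \<open>(t, b, c)\<close> with \<open>t c = b\<^sup>2 + n\<close>.\<close>

lemma sum_of_three_squares_if_quadratic_residues:
  fixes n t B1 b :: int
  assumes "n > 0" "t > 0" "coprime t n" "n dvd B1\<^sup>2 + t" "t dvd b\<^sup>2 + n"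
  shows "sum_of_three_squares n"
proof -
  obtain c where c: "b\<^sup>2 + n = t * c" using assms(5) by auto
  \<comment> \<open>\<open>B1\<^sup>2\<close> is \<open>- t\<close> modulo \<open>n\<close> and
    \<open>t\<close> is prime to \<open>n\<close>, so \<open>B1\<close> can be inverted and later
    cancelled.\<close>
  have "coprime B1 n"
  proof (rule coprimeI)
    fix g assume "g dvd B1" "g dvd n"
    then have "g dvd (B1\<^sup>2 + t) - B1\<^sup>2" using assms(4) by (intro dvd_diff) (auto intro: dvd_trans simp: power2_eq_square)
    then show "is_unit g" using coprime_common_divisor[OF assms(3)] \<open>g dvd n\<close> by simp
  qed
  then obtain r where r: "[B1 * r = 1] (mod n)" using cong_solve_coprime_int by blast
  \<comment> \<open>Chosen to make \<open>B1 * B2 + b\<close> divisible by \<open>n\<close>, which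
    makes the entry \<open>N12\<close> integral.\<close>
  define B2 where "B2 = - b * r"
  have B12: "n dvd B1 * B2 + b"
  proof -
    have "n dvd (B1 * r - 1) * b" using r by (simp add: cong_iff_dvd_diff)
    also have "(B1 * r - 1) * b = - (B1 * B2 + b)" by (simp add: B2_def algebra_simps)
    finally show ?thesis unfolding dvd_minus_iff .
  qed
  \<comment> \<open>Modulo \<open>n\<close>, \<open>B1\<^sup>2\<close> is \<open>- t\<close>,
    \<open>(B1 * B2)\<^sup>2\<close> is \<open>b\<^sup>2\<close>, and \<open>b\<^sup>2\<close>
    equals \<open>t * c\<close>; cancelling \<open>B1\<^sup>2\<close> then makes \<open>N22\<close>
    integral.\<close>
  have "n dvd B1\<^sup>2 * (B2\<^sup>2 + c)"
  proof -
    have "B1\<^sup>2 * (B2\<^sup>2 + c) = (B1 * B2 + b) * (B1 * B2 - b) + c * (B1\<^sup>2 + t) + (b\<^sup>2 - t * c)"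
      by (simp add: algebra_simps power2_eq_square)
    also have "b\<^sup>2 - t * c = - n" using c by simp
    finally show ?thesis using B12 assms(4) by simp
  qed
  then have B22: "n dvd B2\<^sup>2 + c" using \<open>coprime B1 n\<close>
    by (metis coprime_commute coprime_dvd_mult_right_iff coprime_power_right_iff pos2)
  obtain N11 N12 N22 where N: "B1\<^sup>2 + t = n * N11" "B1 * B2 + b = n * N12" "B2\<^sup>2 + c = n * N22"
    using assms(4) B12 B22 by (auto elim!: dvdE)
  have "n * tdet n N11 N22 N12 B2 B1 = (n * N11 - B1\<^sup>2) * (n * N22 - B2\<^sup>2) - (n * N12 - B1 * B2)\<^sup>2"
    by (simp add: tdet_def algebra_simps power2_eq_square)
  also have "\<dots> = t * c - b\<^sup>2" unfolding N[symmetric] by simp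
  also have "\<dots> = n" using c by simp
  finally have "tdet n N11 N22 N12 B2 B1 = 1" using assms(1) by simp
  moreover have "n * N11 - B1\<^sup>2 > 0" using N(1) assms(2) by simp
  ultimately have "sum_of_three_squares (tform n N11 N22 N12 B2 B1 1 0 0)"
    using assms(1) by (intro tform_sum_of_three_squares)
  then show ?thesis by (simp add: tform_def)
qed

section \<open>Divisor sums of real characters\<close>

text \<open>Real Dirichlet characters modulo \<open>N\<close>, the principal one included. Where a
  nontrivial character is required, a point with value -1 is assumed.\<close>

definition real_character :: "nat \<Rightarrow> (nat \<Rightarrow> real) \<Rightarrow> bool" where
  "real_character N \<phi> \<longleftrightarrow> N > 0 \<and> (\<forall>m n. \<phi> (m * n) = \<phi> m * \<phi> n) \<and> (\<forall>m. \<phi> (m + N) = \<phi> m) \<and>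
     (\<forall>m. \<not> coprime m N \<longrightarrow> \<phi> m = 0) \<and> (\<forall>m. coprime m N \<longrightarrow> \<phi> m = 1 \<or> \<phi> m = -1)"

lemma real_characterD:
  assumes "real_character N \<phi>"
  shows "N > 0" "\<phi> (m * n) = \<phi> m * \<phi> n" "\<phi> (m + N) = \<phi> m"
    "\<not> coprime m N \<Longrightarrow> \<phi> m = 0" "coprime m N \<Longrightarrow> \<phi> m = 1 \<or> \<phi> m = -1"
  using assms unfolding real_character_def by blast+

lemma real_characterI:
  assumes "N > 0" "\<And>m n. \<phi> (m * n) = \<phi> m * \<phi> n" "\<And>m. \<phi> (m + N) = \<phi> m"
    "\<And>m. \<not> coprime m N \<Longrightarrow> \<phi> m = 0" "\<And>m. coprime m N \<Longrightarrow> \<phi> m = 1 \<or> \<phi> m = -1"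
  shows "real_character N \<phi>"
  using assms unfolding real_character_def by blast

lemma real_character_cases:
  assumes "real_character N \<phi>"
  shows "\<phi> m = 0 \<or> \<phi> m = 1 \<or> \<phi> m = -1"
  using real_characterD(4,5)[OF assms] by blast

lemma real_character_abs_le: "real_character N \<phi> \<Longrightarrow> \<bar>\<phi> m\<bar> \<le> 1"
  using real_character_cases[of N \<phi> m] by auto

lemma real_character_one:
  assumes "real_character N \<phi>"
  shows "\<phi> 1 = 1"
  using real_characterD(2)[OF assms, of 1 1] real_characterD(5)[OF assms, of 1] by auto

lemma real_character_power:
  assumes "real_character N \<phi>"
  shows "\<phi> (m ^ k) = \<phi> m ^ k"
  by (induction k) (use real_character_one[OF assms] real_characterD(2)[OF assms] in auto)

lemma real_character_square:
  assumes "real_character N \<phi>" "coprime m N"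
  shows "\<phi> m * \<phi> m = 1"
  using real_characterD(5)[OF assms(1), OF assms(2)] by auto

lemma coprime_add_self_nat: "coprime (m + n) n \<longleftrightarrow> coprime m (n :: nat)"
  by (simp only: coprime_iff_gcd_eq_1 gcd_add1)

lemma real_character_principal: "N > 0 \<Longrightarrow> real_character N (\<lambda>m. of_bool (coprime m N))"
  by (intro real_characterI) (auto simp: coprime_add_self_nat)

lemma real_character_mult:
  assumes "real_character N \<phi>" "real_character N \<psi>"
  shows "real_character N (\<lambda>m. \<phi> m * \<psi> m)"
proof (rule real_characterI)
  show "\<phi> m * \<psi> m = 1 \<or> \<phi> m * \<psi> m = - 1" if "coprime m N" for m
    using assms[THEN real_characterD(5), OF that] by auto
qed (use assms[THEN real_characterD(1)] assms[THEN real_characterD(2)] assms[THEN real_characterD(3)]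
      assms[THEN real_characterD(4)] in auto)

text \<open>The coprimality factor turns the empty product into the principal character.\<close>

lemma real_character_prod:
  assumes "N > 0" "finite J" "\<And>j. j \<in> J \<Longrightarrow> real_character N (\<psi> j)"
  shows "real_character N (\<lambda>m. of_bool (coprime m N) * (\<Prod>j\<in>J. \<psi> j m))"
  using assms(2,3)
proof (induction J rule: finite_induct)
  case empty
  then show ?case using real_character_principal[OF assms(1)] by simp
next
  case (insert j J)
  then show ?case
    using real_character_mult[of N "\<psi> j" "\<lambda>m. of_bool (coprime m N) * (\<Prod>j\<in>J. \<psi> j m)"] by (simp add: mult_ac)
qed

lemma real_character_mod:
  assumes "real_character N \<phi>"
  shows "\<phi> (m mod N) = \<phi> m"
proof -
  have "\<phi> (r + k * N) = \<phi> r" for r k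
  proof (induction k)
    case (Suc k)
    then show ?case using real_characterD(3)[OF assms, of "r + k * N"] by (simp add: ac_simps)
  qed simp
  from this[of "m mod N" "m div N"] show ?thesis by simp
qed

text \<open>Multiplication by \<open>a\<close> permutes the residues modulo \<open>N\<close> and
  reverses the sign of the sum.\<close>

lemma real_character_sum_period:
  assumes "real_character N \<phi>" "\<phi> a = -1"
  shows "(\<Sum>m<N. \<phi> m) = 0"
proof -
  have N: "N > 0" by (rule real_characterD(1)[OF assms(1)])
  have co: "coprime a N" using real_characterD(4)[OF assms(1), of a] assms(2) by force
  have "inj_on (\<lambda>m. a * m mod N) {..<N}"
  proof (rule inj_onI)
    fix x y assume xy: "x \<in> {..<N}" "y \<in> {..<N}" "a * x mod N = a * y mod N"
    then have "[a * x = a * y] (mod N)" by (simp add: unique_euclidean_semiring_class.cong_def)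
    then have "[x = y] (mod N)" using cong_mult_lcancel_nat[OF co] by blast
    then show "x = y" using xy by (simp add: unique_euclidean_semiring_class.cong_def)
  qed
  moreover have "(\<lambda>m. a * m mod N) ` {..<N} \<subseteq> {..<N}" using N by auto
  ultimately have bij: "bij_betw (\<lambda>m. a * m mod N) {..<N} {..<N}"
    by (simp add: bij_betw_def endo_inj_surj)
  have "(\<Sum>m<N. \<phi> m) = (\<Sum>m<N. \<phi> (a * m mod N))"
    using sum.reindex_bij_betw[OF bij, of \<phi>] by simp
  also have "\<dots> = - (\<Sum>m<N. \<phi> m)"
    by (simp add: real_character_mod[OF assms(1)] real_characterD(2)[OF assms(1)] assms(2) sum_negf)
  finally show ?thesis by simp
qed

lemma real_character_sum_bound:
  assumes "real_character N \<phi>" "\<phi> a = -1"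
  shows "\<bar>\<Sum>m<x. \<phi> m\<bar> \<le> N"
proof (induction x rule: less_induct)
  case (less x)
  show ?case
  proof (cases "x < N")
    case True
    have "\<bar>\<Sum>m<x. \<phi> m\<bar> \<le> (\<Sum>m<x. \<bar>\<phi> m\<bar>)" by (rule sum_abs)
    also have "\<dots> \<le> (\<Sum>m<x. 1)" by (intro sum_mono real_character_abs_le[OF assms(1)])
    finally show ?thesis using True by simp
  next
    case False
    define y where "y = x - N"
    have x: "x = N + y" using False by (simp add: y_def)
    have "(\<Sum>m<N + y. \<phi> m) = (\<Sum>m<N. \<phi> m) + (\<Sum>m<y. \<phi> (N + m))" for y
      by (induction y) simp_all
    then have "(\<Sum>m<N + y. \<phi> m) = (\<Sum>m<N. \<phi> m) + (\<Sum>m<y. \<phi> (N + m))" .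
    also have "\<dots> = (\<Sum>m<y. \<phi> m)"
      using real_character_sum_period[OF assms] real_characterD(3)[OF assms(1)] by (simp add: add.commute)
    finally show ?thesis using less[of y] x real_characterD(1)[OF assms(1)] by simp
  qed
qed

text \<open>Summation by parts: the boundary terms contribute at most \<open>C\<close> times
  \<open>g a + g z\<close>, the telescoping differences at most \<open>C\<close> times
  \<open>g a - g z\<close>.\<close>

lemma abel_summation_bound:
  fixes \<psi> g :: "nat \<Rightarrow> real"
  assumes S: "\<And>k. \<bar>\<Sum>m<k. \<psi> m\<bar> \<le> C"
    and g: "\<And>m. m \<ge> a \<Longrightarrow> g (Suc m) \<le> g m" "\<And>m. m \<ge> a \<Longrightarrow> g m \<ge> 0"
  shows "\<bar>\<Sum>m=a..<z. \<psi> m * g m\<bar> \<le> 2 * C * g a"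
proof (cases "a \<le> z")
  case True
  define S where "S k = (\<Sum>m<k. \<psi> m)" for k
  have eq: "(\<Sum>m=a..<z. \<psi> m * g m) = S z * g z - S a * g a + (\<Sum>m=a..<z. S (Suc m) * (g m - g (Suc m)))"
    using True
  proof (induction z rule: dec_induct)
    case (step z)
    have "S (Suc z) = S z + \<psi> z" by (simp add: S_def)
    then show ?case unfolding sum.atLeastLessThan_Suc[OF step(1)] step(3) by (simp add: algebra_simps)
  qed simp
  have tel: "(\<Sum>m=a..<z. g m - g (Suc m)) = g a - g z"
    using True by (induction z rule: dec_induct) (simp_all add: sum.atLeastLessThan_Suc)
  have C: "\<bar>S k\<bar> \<le> C" for k using assms(1) by (simp add: S_def)
  have "\<bar>\<Sum>m=a..<z. S (Suc m) * (g m - g (Suc m))\<bar> \<le> (\<Sum>m=a..<z. \<bar>S (Suc m) * (g m - g (Suc m))\<bar>)"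
    by (rule sum_abs)
  also have "\<dots> \<le> (\<Sum>m=a..<z. C * (g m - g (Suc m)))"
    by (intro sum_mono) (auto simp: abs_mult g(1) intro!: mult_right_mono C)
  also have "\<dots> = C * (g a - g z)" unfolding tel[symmetric] sum_distrib_left ..
  finally have 1: "\<bar>\<Sum>m=a..<z. S (Suc m) * (g m - g (Suc m))\<bar> \<le> C * (g a - g z)" .
  have 2: "\<bar>S k * g k\<bar> \<le> C * g k" if "k \<ge> a" for k
    using g(2)[OF that] C by (simp add: abs_mult mult_right_mono)
  show ?thesis using 1 2[of a] 2[of z] True unfolding eq by (simp add: algebra_simps)
next
  case False
  have "C \<ge> 0" using S[of 0] by simp
  then show ?thesis using False g(2)[of a] by simp
qed

text \<open>The start \<open>a \<ge> 1\<close> avoids the value \<open>1 / sqrt 0 = 0\<close>, at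
  which the weight would not be decreasing.\<close>

lemma character_tail_bound:
  assumes "real_character N \<phi>" "\<phi> b = -1" "a \<ge> 1"
  shows "\<bar>\<Sum>m=a..<z. \<phi> m / sqrt m\<bar> \<le> 2 * real N / sqrt a"
  using abel_summation_bound[of \<phi> N a "\<lambda>m. 1 / sqrt m" z] real_character_sum_bound[OF assms(1,2)] assms(3)
  by (simp add: frac_le)

lemma sum_inverse_sqrt_le: "(\<Sum>e=1..s. 1 / sqrt (real e)) \<le> 2 * sqrt s"
proof (induction s)
  case (Suc s)
  define x y where "x = sqrt s" and "y = sqrt (Suc s)"
  have y: "y > 0" "x \<ge> 0" "y\<^sup>2 = x\<^sup>2 + 1" by (simp_all add: x_def y_def)
  have "2 * x * y \<le> x\<^sup>2 + y\<^sup>2" using sum_squares_ge_zero[of "x - y" 0] by (simp add: power2_eq_square algebra_simps)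
  then have "1 \<le> (2 * y - 2 * x) * y" using y by (simp add: power2_eq_square algebra_simps)
  then have "1 / y \<le> 2 * y - 2 * x" using y by (simp add: divide_le_eq)
  then show ?case using Suc by (simp add: x_def y_def)
qed simp

section \<open>The hyperbola method\<close>

definition hyperbola_region :: "nat \<Rightarrow> (nat \<times> nat) set" where
  "hyperbola_region x = {(d, e). d \<ge> 1 \<and> e \<ge> 1 \<and> d * e \<le> x}"

lemma sum_divisors_eq_hyperbola:
  fixes h :: "nat \<Rightarrow> nat \<Rightarrow> 'a :: comm_monoid_add"
  shows "(\<Sum>t=1..x. \<Sum>d | d dvd t. h d (t div d)) = (\<Sum>(d, e)\<in>hyperbola_region x. h d e)"
proof -
  have "(\<Sum>t=1..x. \<Sum>d | d dvd t. h d (t div d)) = (\<Sum>(t, d)\<in>(SIGMA t:{1..x}. {d. d dvd t}). h d (t div d))"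
    by (rule sum.Sigma) auto
  also have "\<dots> = (\<Sum>(d, e)\<in>hyperbola_region x. h d e)"
  proof (rule sum.reindex_bij_witness[of _ "\<lambda>(d, e). (d * e, d)" "\<lambda>(t, d). (d, t div d)"])
    fix u assume u: "u \<in> (SIGMA t:{1..x}. {d. d dvd t})"
    then obtain t d where td: "u = (t, d)" "d dvd t" "1 \<le> t" "t \<le> x" by auto
    then obtain e where e: "t = d * e" by auto
    show "(case u of (t, d) \<Rightarrow> (d, t div d)) \<in> hyperbola_region x"
    proof -
      have "d \<ge> 1" "e \<ge> 1" using td(3) e by (auto simp: Suc_le_eq intro!: Nat.gr0I)
      then show ?thesis using td e by (simp add: hyperbola_region_def)
    qed
    show "(case case u of (t, d) \<Rightarrow> (d, t div d) of (d, e) \<Rightarrow> (d * e, d)) = u" using td by simp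
  qed (auto simp: hyperbola_region_def Suc_le_eq)
  finally show ?thesis .
qed

text \<open>Dirichlet's hyperbola method: both characters oscillate, so the weight \<open>1 / sqrt (d e)\<close>
  is small enough for the double sum to stay bounded.\<close>

lemma hyperbola_sum_bound:
  assumes \<phi>: "real_character N \<phi>" "\<phi> a = -1" and \<psi>: "real_character N \<psi>" "\<psi> b = -1"
  shows "\<bar>\<Sum>(d, e)\<in>hyperbola_region (s\<^sup>2). \<phi> d * \<psi> e / (sqrt d * sqrt e)\<bar> \<le> 4 * (real N)\<^sup>2 + 8 * real N"
proof (cases "s = 0")
  case True
  have "hyperbola_region 0 = {}" by (auto simp: hyperbola_region_def)
  then show ?thesis using True by simp
next
  case False
  define h where "h d e = \<phi> d * \<psi> e / (sqrt (real d) * sqrt (real e))" for d e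
  \<comment> \<open>The region is cut into the square \<open>R\<close>, the part \<open>U\<close>
    with second coordinate above \<open>s\<close>, and the mirror image \<open>V\<close> of
    \<open>U\<close>.\<close>
  define R where "R = {1..s} \<times> {1..s}"
  define U where "U = (SIGMA d:{1..s}. {Suc s..<Suc (s\<^sup>2 div d)})"
  define V where "V = prod.swap ` U"
  have div: "e \<le> s\<^sup>2 div d \<longleftrightarrow> d * e \<le> s\<^sup>2" if "d \<ge> 1" for d e
    using that by (simp add: less_eq_div_iff_mult_less_eq mult.commute)
  have H: "hyperbola_region (s\<^sup>2) = R \<union> U \<union> V"
  proof (intro equalityI subsetI)
    fix u assume "u \<in> hyperbola_region (s\<^sup>2)"
    then obtain d e where u: "u = (d, e)" "d \<ge> 1" "e \<ge> 1" "d * e \<le> s\<^sup>2" by (auto simp: hyperbola_region_def)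
    have "\<not> (d > s \<and> e > s)"
    proof
      assume "d > s \<and> e > s"
      then have "s * s < d * e" by (intro mult_strict_mono) (use False in auto)
      then show False using u(4) by (simp add: power2_eq_square)
    qed
    then consider "d \<le> s" "e \<le> s" | "d \<le> s" "e > s" | "d > s" "e \<le> s" by linarith
    then show "u \<in> R \<union> U \<union> V"
    proof cases
      case 3
      then have "(e, d) \<in> U" using u by (simp add: U_def less_Suc_eq_le div mult.commute)
      then have "prod.swap (e, d) \<in> V" unfolding V_def by blast
      then show ?thesis using u by simp
    qed (use u in \<open>simp_all add: R_def U_def less_Suc_eq_le div\<close>)
  next
    fix u assume "u \<in> R \<union> U \<union> V"
    moreover have "d * e \<le> s\<^sup>2" if "d \<le> s" "e \<le> s" for d e
      using that by (simp add: power2_eq_square mult_mono)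
    ultimately show "u \<in> hyperbola_region (s\<^sup>2)"
      by (auto simp: R_def U_def V_def hyperbola_region_def less_Suc_eq_le div mult.commute)
  qed
  have fin: "finite R" "finite U" "finite V" by (simp_all add: R_def U_def V_def)
  have disj: "R \<inter> U = {}" "(R \<union> U) \<inter> V = {}" by (auto simp: R_def U_def V_def)
  have s1: "(\<Sum>(d, e)\<in>hyperbola_region (s\<^sup>2). h d e) = (\<Sum>(d, e)\<in>R. h d e) + (\<Sum>(d, e)\<in>U. h d e) + (\<Sum>(d, e)\<in>V. h d e)"
    unfolding H using fin disj by (simp add: sum.union_disjoint)
  have R: "\<bar>\<Sum>(d, e)\<in>R. h d e\<bar> \<le> 4 * (real N)\<^sup>2"
  proof -
    have b1: "\<bar>\<Sum>d=1..s. \<phi> d / sqrt d\<bar> \<le> 2 * real N" and b2: "\<bar>\<Sum>d=1..s. \<psi> d / sqrt d\<bar> \<le> 2 * real N"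
      using character_tail_bound[OF \<phi>, of 1 "Suc s"] character_tail_bound[OF \<psi>, of 1 "Suc s"]
      by (simp_all add: atLeastLessThanSuc_atLeastAtMost)
    have "(\<Sum>(d, e)\<in>R. h d e) = (\<Sum>d=1..s. \<phi> d / sqrt d) * (\<Sum>e=1..s. \<psi> e / sqrt e)"
      unfolding R_def sum_product sum.cartesian_product h_def by (simp add: case_prod_unfold)
    also have "\<bar>\<dots>\<bar> \<le> (2 * real N) * (2 * real N)" unfolding abs_mult using b1 b2 by (intro mult_mono) auto
    finally show ?thesis by (simp add: power2_eq_square)
  qed
  \<comment> \<open>Stated for arbitrary characters because \<open>V\<close> is treated as
    \<open>U\<close> with the two characters exchanged. Each inner sum is at most
    \<open>2 * N / sqrt s\<close>, and the outer weights add up to at most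
    \<open>2 * sqrt s\<close>.\<close>
  have tail: "\<bar>\<Sum>(d, e)\<in>U. \<phi>' d * \<psi>' e / (sqrt d * sqrt e)\<bar> \<le> 4 * real N"
    if \<phi>': "real_character N \<phi>'" and \<psi>': "real_character N \<psi>'" "\<psi>' c = -1" for \<phi>' \<psi>' c
  proof -
    have "(\<Sum>(d, e)\<in>U. \<phi>' d * \<psi>' e / (sqrt d * sqrt e)) = (\<Sum>d=1..s. \<Sum>e=Suc s..<Suc (s\<^sup>2 div d). \<phi>' d * \<psi>' e / (sqrt d * sqrt e))"
      unfolding U_def by (rule sum.Sigma[symmetric]) auto
    also have "\<dots> = (\<Sum>d=1..s. \<phi>' d / sqrt d * (\<Sum>e=Suc s..<Suc (s\<^sup>2 div d). \<psi>' e / sqrt e))"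
      unfolding sum_distrib_left times_divide_times_eq ..
    also have "\<bar>\<dots>\<bar> \<le> (\<Sum>d=1..s. \<bar>\<phi>' d / sqrt d * (\<Sum>e=Suc s..<Suc (s\<^sup>2 div d). \<psi>' e / sqrt e)\<bar>)"
      by (rule sum_abs)
    also have "\<dots> \<le> (\<Sum>d=1..s. 1 / sqrt d * (2 * real N / sqrt s))"
    proof (rule sum_mono)
      fix d assume d: "d \<in> {1..s}"
      have "\<bar>\<Sum>e=Suc s..<Suc (s\<^sup>2 div d). \<psi>' e / sqrt e\<bar> \<le> 2 * real N / sqrt (Suc s)"
        by (rule character_tail_bound[OF \<psi>']) simp
      also have "\<dots> \<le> 2 * real N / sqrt s" using False by (intro frac_le) auto
      finally have "\<bar>\<Sum>e=Suc s..<Suc (s\<^sup>2 div d). \<psi>' e / sqrt e\<bar> \<le> 2 * real N / sqrt s" .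
      moreover have "\<bar>\<phi>' d / sqrt d\<bar> \<le> 1 / sqrt d"
        using real_character_abs_le[OF \<phi>', of d] by (simp add: divide_right_mono)
      ultimately show "\<bar>\<phi>' d / sqrt d * (\<Sum>e=Suc s..<Suc (s\<^sup>2 div d). \<psi>' e / sqrt e)\<bar> \<le> 1 / sqrt d * (2 * real N / sqrt s)"
        unfolding abs_mult by (intro mult_mono) auto
    qed
    also have "\<dots> = (\<Sum>d=1..s. 1 / sqrt d) * (2 * real N / sqrt s)" by (rule sum_distrib_right[symmetric])
    also have "\<dots> \<le> (2 * sqrt s) * (2 * real N / sqrt s)" by (intro mult_right_mono sum_inverse_sqrt_le) auto
    also have "\<dots> = 4 * real N" using False by simp
    finally show ?thesis .
  qed
  have U: "\<bar>\<Sum>(d, e)\<in>U. h d e\<bar> \<le> 4 * real N" using tail[OF \<phi>(1) \<psi>] by (simp add: h_def)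
  have "(\<Sum>(d, e)\<in>V. h d e) = (\<Sum>(d, e)\<in>U. h e d)"
    unfolding V_def by (subst sum.reindex) (auto simp: case_prod_unfold)
  then have V: "\<bar>\<Sum>(d, e)\<in>V. h d e\<bar> \<le> 4 * real N" using tail[OF \<psi>(1) \<phi>] by (simp add: h_def mult_ac)
  show ?thesis using R U V s1 unfolding h_def by linarith
qed

section \<open>Dirichlet convolution of a real character with the constant 1\<close>

definition divisor_sum :: "(nat \<Rightarrow> real) \<Rightarrow> nat \<Rightarrow> real" where
  "divisor_sum \<phi> t = (\<Sum>d | d dvd t. \<phi> d)"

lemma bij_betw_divisors_prime_power_mult:
  fixes p m :: nat
  assumes "prime p" "\<not> p dvd m"
  shows "bij_betw (\<lambda>(i, d). p ^ i * d) ({..k} \<times> {d. d dvd m}) {d. d dvd p ^ k * m}"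
proof (rule bij_betwI')
  fix u v assume uv: "u \<in> {..k} \<times> {d. d dvd m}" "v \<in> {..k} \<times> {d. d dvd m}"
  obtain i d where u: "u = (i, d)" by (cases u)
  obtain j e where v: "v = (j, e)" by (cases v)
  have nd: "\<not> p dvd d" "\<not> p dvd e" using uv assms(2) by (auto simp: u v)
  have mult: "multiplicity p (p ^ l * x) = l" if "\<not> p dvd x" for l x
    using assms(1) that by (intro multiplicity_eqI) auto
  show "((case u of (i, d) \<Rightarrow> p ^ i * d) = (case v of (i, d) \<Rightarrow> p ^ i * d)) = (u = v)"
  proof
    assume "(case u of (i, d) \<Rightarrow> p ^ i * d) = (case v of (i, d) \<Rightarrow> p ^ i * d)"
    then have eq: "p ^ i * d = p ^ j * e" by (simp add: u v)
    then have "i = j" using mult nd by metis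
    then show "u = v" using eq assms(1) by (simp add: u v)
  qed auto
next
  fix u assume "u \<in> {..k} \<times> {d. d dvd m}"
  then show "(case u of (i, d) \<Rightarrow> p ^ i * d) \<in> {d. d dvd p ^ k * m}"
    by (auto intro!: mult_dvd_mono le_imp_power_dvd)
next
  fix d assume "d \<in> {d. d dvd p ^ k * m}"
  then obtain b c where "d = b * c" "b dvd p ^ k" "c dvd m" using division_decomp by blast
  then show "\<exists>u\<in>{..k} \<times> {d. d dvd m}. d = (case u of (i, d) \<Rightarrow> p ^ i * d)"
    using divides_primepow_nat[OF assms(1)] by force
qed

lemma divisor_sum_prime_power_mult:
  assumes "real_character N \<phi>" "prime p" "\<not> p dvd m"
  shows "divisor_sum \<phi> (p ^ k * m) = (\<Sum>i\<le>k. \<phi> p ^ i) * divisor_sum \<phi> m"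
proof -
  have "divisor_sum \<phi> (p ^ k * m) = (\<Sum>(i, d)\<in>{..k} \<times> {d. d dvd m}. \<phi> (p ^ i * d))"
    unfolding divisor_sum_def
    by (subst sum.reindex_bij_betw[OF bij_betw_divisors_prime_power_mult[OF assms(2,3)], symmetric])
      (simp add: case_prod_unfold)
  also have "\<dots> = (\<Sum>(i, d)\<in>{..k} \<times> {d. d dvd m}. \<phi> p ^ i * \<phi> d)"
    using real_characterD(2)[OF assms(1)] real_character_power[OF assms(1)] by simp
  finally show ?thesis by (simp add: divisor_sum_def sum_product sum.cartesian_product)
qed

text \<open>These sums are the local factors of \<open>divisor_sum\<close>. Their signs decide its
  nonnegativity, its lower bound at squares and its vanishing.\<close>

lemma sum_powers_of_sign:
  fixes c :: real
  assumes "c = 0 \<or> c = 1 \<or> c = -1"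
  shows "(\<Sum>i\<le>k. c ^ i) \<ge> 0" "even k \<Longrightarrow> (\<Sum>i\<le>k. c ^ i) \<ge> 1" "odd k \<Longrightarrow> c = -1 \<Longrightarrow> (\<Sum>i\<le>k. c ^ i) = 0"
proof -
  have m: "(\<Sum>i\<le>k. (-1::real) ^ i) = (if even k then 1 else 0)" for k
    by (induction k) auto
  have z: "(\<Sum>i\<le>k. (0::real) ^ i) = 1" for k
    by (induction k) auto
  show "(\<Sum>i\<le>k. c ^ i) \<ge> 0" "even k \<Longrightarrow> (\<Sum>i\<le>k. c ^ i) \<ge> 1" "odd k \<Longrightarrow> c = -1 \<Longrightarrow> (\<Sum>i\<le>k. c ^ i) = 0"
    using assms by (auto simp: m z)
qed

lemma prime_power_split:
  fixes t :: nat
  assumes "t > 0" "prime p"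
  obtains m where "t = p ^ multiplicity p t * m" "\<not> p dvd m" "m > 0" "p dvd t \<Longrightarrow> m < t"
proof (rule multiplicity_decompose'[of t p])
  fix y assume y: "t = p ^ multiplicity p t * y" "\<not> p dvd y"
  have "y > 0" using y(2) by (intro Nat.gr0I) auto
  moreover have "y < t" if "p dvd t"
  proof -
    have "multiplicity p t > 0"
      using that assms by (simp add: prime_multiplicity_gt_zero_iff)
    then have "1 < p ^ multiplicity p t" using prime_gt_1_nat[OF assms(2)] by (intro one_less_power)
    then show ?thesis using \<open>y > 0\<close> by (subst y(1)) simp
  qed
  ultimately show thesis using that y by blast
qed (use assms in auto)

lemma divisor_sum_nonneg:
  assumes "real_character N \<phi>" "t > 0"
  shows "divisor_sum \<phi> t \<ge> 0"
  using assms(2)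
proof (induction t rule: less_induct)
  case (less t)
  show ?case
  proof (cases "t = 1")
    case True
    then show ?thesis using real_character_one[OF assms(1)] by (simp add: divisor_sum_def)
  next
    case False
    then obtain p where p: "prime p" "p dvd t" using prime_factor_nat by blast
    obtain m where m: "t = p ^ multiplicity p t * m" "\<not> p dvd m" "m > 0" "m < t"
      using prime_power_split[OF less(2) p(1)] p(2) by blast
    then have "divisor_sum \<phi> m \<ge> 0" using less(1) m(3) by blast
    then show ?thesis using sum_powers_of_sign(1)[OF real_character_cases[OF assms(1)]]
      by (subst m(1)) (simp add: divisor_sum_prime_power_mult[OF assms(1) p(1) m(2)])
  qed
qed

text \<open>All prime exponents are even, so each local factor is at least 1.\<close>

lemma divisor_sum_square_ge_1:
  assumes "real_character N \<phi>" "s > 0"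
  shows "divisor_sum \<phi> (s\<^sup>2) \<ge> 1"
  using assms(2)
proof (induction s rule: less_induct)
  case (less s)
  show ?case
  proof (cases "s = 1")
    case True
    then show ?thesis using real_character_one[OF assms(1)] by (simp add: divisor_sum_def)
  next
    case False
    then obtain p where p: "prime p" "p dvd s" using prime_factor_nat by blast
    define k where "k = multiplicity p s"
    obtain m where m: "s = p ^ k * m" "\<not> p dvd m" "m > 0" "m < s"
      using prime_power_split[OF less(2) p(1)] p(2) unfolding k_def by blast
    then have 1: "divisor_sum \<phi> (m\<^sup>2) \<ge> 1" using less(1) m(3) by blast
    have 2: "(\<Sum>i\<le>2 * k. \<phi> p ^ i) \<ge> 1"
      by (rule sum_powers_of_sign(2)[OF real_character_cases[OF assms(1)]]) simp
    have nd: "\<not> p dvd m\<^sup>2" using m(2) p(1) prime_dvd_power by blast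
    have "s\<^sup>2 = p ^ (2 * k) * m\<^sup>2" by (simp add: m(1) power_mult_distrib power_mult[symmetric] mult.commute)
    then have "divisor_sum \<phi> (s\<^sup>2) = (\<Sum>i\<le>2 * k. \<phi> p ^ i) * divisor_sum \<phi> (m\<^sup>2)"
      using divisor_sum_prime_power_mult[OF assms(1) p(1) nd] by simp
    moreover have "1 * 1 \<le> (\<Sum>i\<le>2 * k. \<phi> p ^ i) * divisor_sum \<phi> (m\<^sup>2)"
      using 2 by (intro mult_mono 2 1) auto
    ultimately show ?thesis by simp
  qed
qed

text \<open>An odd exponent at a prime with character value -1 would produce a vanishing local
  factor. Thus a nonzero weight controls every prime of the squarefree part of \<open>t\<close>,
  which replaces the primality of \<open>t\<close>.\<close>

lemma divisor_sum_nonzero_imp_character_one: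
  assumes "real_character N \<phi>" "divisor_sum \<phi> t \<noteq> 0" "t > 0" "prime p" "odd (multiplicity p t)" "coprime p N"
  shows "\<phi> p = 1"
proof (rule ccontr)
  assume "\<phi> p \<noteq> 1"
  then have "\<phi> p = -1" using real_characterD(5)[OF assms(1,6)] by blast
  obtain m where m: "t = p ^ multiplicity p t * m" "\<not> p dvd m"
    using prime_power_split[OF assms(3,4)] by blast
  have "divisor_sum \<phi> t = (\<Sum>i\<le>multiplicity p t. \<phi> p ^ i) * divisor_sum \<phi> m"
    using divisor_sum_prime_power_mult[OF assms(1,4) m(2)] m(1) by metis
  then show False
    using assms(2) sum_powers_of_sign(3)[OF _ assms(5) \<open>\<phi> p = -1\<close>] \<open>\<phi> p = -1\<close> by simp
qed

text \<open>The twist by \<open>\<psi>\<close> is the convolution of \<open>\<phi> \<psi>\<close>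
  with \<open>\<psi>\<close>; both are nontrivial, so the hyperbola bound applies.\<close>

lemma twisted_divisor_sum_bound:
  assumes \<phi>: "real_character N \<phi>" and \<psi>: "real_character N \<psi>" "\<psi> b = -1" and "\<phi> a * \<psi> a = -1"
  shows "\<bar>\<Sum>t=1..s\<^sup>2. divisor_sum \<phi> t * \<psi> t / sqrt t\<bar> \<le> 4 * (real N)\<^sup>2 + 8 * real N"
proof -
  have "(\<Sum>t=1..s\<^sup>2. divisor_sum \<phi> t * \<psi> t / sqrt t)
      = (\<Sum>t=1..s\<^sup>2. \<Sum>d | d dvd t. (\<phi> d * \<psi> d) * \<psi> (t div d) / (sqrt d * sqrt (t div d)))"
  proof (rule sum.cong[OF refl])
    fix t
    have "\<phi> d * \<psi> t / sqrt t = (\<phi> d * \<psi> d) * \<psi> (t div d) / (sqrt d * sqrt (t div d))" if dt: "d dvd t" for d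
    proof -
      obtain e where e: "t = d * e" using dt by auto
      show ?thesis
      proof (cases "d = 0")
        case False
        then show ?thesis by (simp add: e real_characterD(2)[OF \<psi>(1)] real_sqrt_mult)
      qed (use e in simp)
    qed
    then show "divisor_sum \<phi> t * \<psi> t / sqrt t = (\<Sum>d | d dvd t. (\<phi> d * \<psi> d) * \<psi> (t div d) / (sqrt d * sqrt (t div d)))"
      by (simp add: divisor_sum_def sum_distrib_right sum_divide_distrib)
  qed
  also have "\<dots> = (\<Sum>(d, e)\<in>hyperbola_region (s\<^sup>2). (\<phi> d * \<psi> d) * \<psi> e / (sqrt d * sqrt e))"
    by (rule sum_divisors_eq_hyperbola)
  finally show ?thesis
    using hyperbola_sum_bound[OF real_character_mult[OF \<phi> \<psi>(1)] assms(4) \<psi>, of s] by simp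
qed

text \<open>For \<open>t\<close> prime to \<open>N\<close>, \<open>\<phi> d * \<phi> t\<close> is
  \<open>\<phi> (t div d)\<close>, so the twist only permutes the divisors. This covers the twist by
  \<open>\<phi>\<close> itself, where one character in the hyperbola bound would be
  principal.\<close>

lemma divisor_sum_mult_self_nonneg:
  assumes "real_character N \<phi>" "t > 0"
  shows "divisor_sum \<phi> t * \<phi> t \<ge> 0"
proof (cases "coprime t N")
  case True
  have "divisor_sum \<phi> t * \<phi> t = (\<Sum>d | d dvd t. \<phi> (t div d))"
    unfolding divisor_sum_def sum_distrib_right
  proof (rule sum.cong[OF refl])
    fix d assume "d \<in> {d. d dvd t}"
    then obtain e where e: "t = d * e" by auto
    have "d \<noteq> 0" using e assms(2) by auto
    moreover have "\<phi> d * \<phi> d = 1" using real_character_square[OF assms(1)] True e by simp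
    ultimately show "\<phi> d * \<phi> t = \<phi> (t div d)" by (simp add: e real_characterD(2)[OF assms(1)])
  qed
  also have "\<dots> = divisor_sum \<phi> t" unfolding divisor_sum_def
    using assms(2) by (intro sum.reindex_bij_witness[of _ "\<lambda>d. t div d" "\<lambda>d. t div d"]) auto
  finally show ?thesis using divisor_sum_nonneg[OF assms] by (simp only:)
next
  case False
  then show ?thesis using real_characterD(4)[OF assms(1)] by simp
qed

text \<open>The progression \<open>1 + N * k\<close> consists of numbers prime to \<open>N\<close>,
  and its reciprocals are at least \<open>1 / N\<close> times those of \<open>k + 1\<close>.\<close>

lemma coprime_harmonic_unbounded:
  assumes "N > 0"
  shows "\<exists>s. (\<Sum>m=1..s. of_bool (coprime m N) / real m) > C"
proof (rule ccontr)
  assume "\<not> ?thesis"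
  then have le: "(\<Sum>m=1..s. of_bool (coprime m N) / real m) \<le> C" for s by (simp add: not_less)
  have "(\<Sum>k<K. inverse (real (Suc k))) \<le> N * C" for K
  proof -
    have "(\<Sum>k<K. inverse (real (Suc k))) \<le> (\<Sum>k<K. N * (1 / real (1 + N * k)))"
    proof (rule sum_mono)
      fix k
      have "real (1 + N * k) \<le> real (N * Suc k)" using assms by (intro of_nat_mono) simp
      moreover have "real (1 + N * k) > 0" by linarith
      ultimately show "inverse (real (Suc k)) \<le> N * (1 / real (1 + N * k))"
        using assms by (simp add: field_simps)
    qed
    also have "\<dots> = N * (\<Sum>k<K. 1 / real (1 + N * k))" by (simp only: sum_distrib_left)
    also have "(\<Sum>k<K. 1 / real (1 + N * k)) = (\<Sum>m\<in>(\<lambda>k. 1 + N * k) ` {..<K}. of_bool (coprime m N) / real m)"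
    proof -
      have "coprime (1 + N * k) N" for k
      proof (rule coprimeI)
        fix g assume "g dvd 1 + N * k" "g dvd N"
        then show "is_unit g" using dvd_add_left_iff[of g "N * k" 1] by simp
      qed
      then show ?thesis using assms by (subst sum.reindex) (auto simp: inj_on_def)
    qed
    also have "\<dots> \<le> (\<Sum>m=1..1 + N * K. of_bool (coprime m N) / real m)"
      by (intro sum_mono2) auto
    also have "\<dots> \<le> C" by (rule le)
    finally show ?thesis by (simp add: mult_left_mono)
  qed
  then have "summable (\<lambda>k. inverse (real (Suc k)))"
    by (intro summableI_nonneg_bounded[where x = "N * C"]) auto
  then show False using not_summable_harmonic[where 'a = real] summable_Suc_iff[of "\<lambda>n. inverse (real n)"] by blast
qed

text \<open>If no such \<open>t\<close> existed, the nonnegative weights \<open>divisor_sum \<phi> t \<Prod>(1 + \<epsilon>\<^sub>j \<psi>\<^sub>j(t)) / sqrt t\<close> would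
  all vanish. Expanding the product, the main term is at least a harmonic sum (from square \<open>t\<close>),
  while all other terms are bounded below.\<close>

lemma exists_prescribed_characters:
  assumes \<phi>: "real_character N \<phi>" and "finite I"
    and \<psi>: "\<And>j. j \<in> I \<Longrightarrow> real_character N (\<psi> j)" and \<epsilon>: "\<And>j. j \<in> I \<Longrightarrow> \<epsilon> j = 1 \<or> \<epsilon> j = (-1 :: real)"
    and ind: "\<And>J. J \<subseteq> I \<Longrightarrow> J \<noteq> {} \<Longrightarrow> \<exists>a. coprime a N \<and> (\<Prod>j\<in>J. \<psi> j a) = -1"
    and ind': "\<And>J. J \<subseteq> I \<Longrightarrow> J \<noteq> {} \<Longrightarrow> (\<exists>a. coprime a N \<and> \<phi> a * (\<Prod>j\<in>J. \<psi> j a) = -1) \<or>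
      ((\<forall>a. coprime a N \<longrightarrow> \<phi> a = (\<Prod>j\<in>J. \<psi> j a)) \<and> (\<Prod>j\<in>J. \<epsilon> j) = 1)"
  shows "\<exists>t>0. coprime t N \<and> divisor_sum \<phi> t > 0 \<and> (\<forall>j\<in>I. \<psi> j t = \<epsilon> j)"
proof (rule ccontr)
  assume neg: "\<not> ?thesis"
  have N: "N > 0" by (rule real_characterD(1)[OF \<phi>])
  define \<Psi> where "\<Psi> J t = of_bool (coprime t N) * (\<Prod>j\<in>J. \<psi> j t)" for J t
  define E where "E J = (\<Prod>j\<in>J. \<epsilon> j)" for J
  define S where "S J s = (\<Sum>t=1..s\<^sup>2. divisor_sum \<phi> t * \<Psi> J t / sqrt t)" for J s
  define C where "C = 4 * (real N)\<^sup>2 + 8 * real N"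
  have rc: "real_character N (\<Psi> J)" if "J \<subseteq> I" for J
    unfolding \<Psi>_def using that \<psi> assms(2) by (intro real_character_prod[OF N]) (auto intro: finite_subset)
  \<comment> \<open>A wrong sign \<open>\<psi> j t = - \<epsilon> j\<close> makes the factor of
    index \<open>j\<close> vanish.\<close>
  have "divisor_sum \<phi> t * (of_bool (coprime t N) * (\<Prod>j\<in>I. \<epsilon> j * \<psi> j t + 1)) = 0" if t0: "t > 0" for t
  proof (cases "coprime t N \<and> divisor_sum \<phi> t > 0")
    case True
    then obtain j where j: "j \<in> I" "\<psi> j t \<noteq> \<epsilon> j" using neg t0 by blast
    have "\<psi> j t = 1 \<or> \<psi> j t = -1" using real_characterD(5)[OF \<psi>[OF j(1)]] True by blast
    then have "\<epsilon> j * \<psi> j t + 1 = 0" using j \<epsilon>[OF j(1)] by auto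
    then have "(\<Prod>j\<in>I. \<epsilon> j * \<psi> j t + 1) = 0" using j(1) assms(2) by (intro prod_zero) auto
    then show ?thesis by simp
  next
    case False
    then show ?thesis using divisor_sum_nonneg[OF \<phi> t0] by auto
  qed
  moreover have "of_bool (coprime t N) * (\<Prod>j\<in>I. \<epsilon> j * \<psi> j t + 1) = (\<Sum>J\<in>Pow I. E J * \<Psi> J t)" for t
    unfolding prod_add[OF assms(2)] by (simp add: sum_distrib_left E_def \<Psi>_def prod.distrib mult_ac)
  ultimately have "divisor_sum \<phi> t * (\<Sum>J\<in>Pow I. E J * \<Psi> J t) = 0" if "t > 0" for t
    using that by simp
  then have "0 = (\<Sum>t=1..s\<^sup>2. divisor_sum \<phi> t * (\<Sum>J\<in>Pow I. E J * \<Psi> J t) / sqrt t)" for s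
    by (intro sum.neutral[symmetric]) auto
  also have "(\<Sum>t=1..s\<^sup>2. divisor_sum \<phi> t * (\<Sum>J\<in>Pow I. E J * \<Psi> J t) / sqrt t) = (\<Sum>J\<in>Pow I. E J * S J s)" for s
  proof -
    have "(\<Sum>t=1..s\<^sup>2. divisor_sum \<phi> t * (\<Sum>J\<in>Pow I. E J * \<Psi> J t) / sqrt t)
        = (\<Sum>t=1..s\<^sup>2. \<Sum>J\<in>Pow I. E J * (divisor_sum \<phi> t * \<Psi> J t / sqrt t))"
      by (simp add: sum_distrib_left sum_divide_distrib mult_ac)
    also have "\<dots> = (\<Sum>J\<in>Pow I. \<Sum>t=1..s\<^sup>2. E J * (divisor_sum \<phi> t * \<Psi> J t / sqrt t))" by (rule sum.swap)
    finally show ?thesis by (simp add: S_def sum_distrib_left)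
  qed
  also have "(\<Sum>J\<in>Pow I. E J * S J s) = S {} s + (\<Sum>J\<in>Pow I - {{}}. E J * S J s)" for s
    using assms(2) by (subst sum.remove[of _ "{}"]) (auto simp: E_def)
  finally have zero: "0 = S {} s + (\<Sum>J\<in>Pow I - {{}}. E J * S J s)" for s .
  have lower: "- C \<le> E J * S J s" if J: "J \<in> Pow I - {{}}" for J s
  proof -
    have E: "\<bar>E J\<bar> = 1"
    proof -
      have "\<forall>j\<in>J. \<bar>\<epsilon> j\<bar> = 1" using J \<epsilon> by fastforce
      then show ?thesis unfolding E_def abs_prod by (rule prod.neutral)
    qed
    obtain b where "coprime b N" "(\<Prod>j\<in>J. \<psi> j b) = -1" using ind[of J] J by blast
    then have b: "\<Psi> J b = -1" by (simp add: \<Psi>_def)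
    have "\<Psi> J a = (\<Prod>j\<in>J. \<psi> j a)" if "coprime a N" for a using that by (simp add: \<Psi>_def)
    \<comment> \<open>Either both characters of the twist are nontrivial and the hyperbola bound
      applies, or \<open>\<Psi> J\<close> is \<open>\<phi>\<close> itself and the nonnegative sum
      enters with sign +1.\<close>
    then consider a where "\<phi> a * \<Psi> J a = -1" | "\<And>a. coprime a N \<Longrightarrow> \<phi> a = \<Psi> J a" "E J = 1"
      using ind'[of J] J unfolding E_def by (metis DiffE PowD insertI1)
    then show ?thesis
    proof cases
      case 1
      have "\<bar>S J s\<bar> \<le> C" unfolding S_def C_def
        using twisted_divisor_sum_bound[OF \<phi> rc b 1, of s] J by simp
      then have "\<bar>E J * S J s\<bar> \<le> C" using E by (simp add: abs_mult)
      then show ?thesis by linarith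
    next
      case 2
      have "\<Psi> J t = \<phi> t" for t
        using 2(1)[of t] real_characterD(4)[OF \<phi>, of t] by (cases "coprime t N") (auto simp: \<Psi>_def)
      then have "S J s \<ge> 0" unfolding S_def
        by (intro sum_nonneg divide_nonneg_nonneg) (auto intro!: divisor_sum_mult_self_nonneg[OF \<phi>])
      moreover have "C \<ge> 0" by (simp add: C_def)
      ultimately show ?thesis using 2(2) by simp
    qed
  qed
  have upper: "S {} s \<le> card (Pow I - {{}}) * C" for s
  proof -
    have "(\<Sum>J\<in>Pow I - {{}}. - C) \<le> (\<Sum>J\<in>Pow I - {{}}. E J * S J s)" by (intro sum_mono lower)
    then show ?thesis using zero[of s] by simp
  qed
  have main: "(\<Sum>m=1..s. of_bool (coprime m N) / real m) \<le> S {} s" for s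
  proof -
    have "(\<Sum>m=1..s. of_bool (coprime m N) / real m) \<le> (\<Sum>m=1..s. divisor_sum \<phi> (m\<^sup>2) * of_bool (coprime (m\<^sup>2) N) / sqrt (m\<^sup>2))"
      using divisor_sum_square_ge_1[OF \<phi>] by (intro sum_mono) (auto simp: divide_right_mono)
    also have "\<dots> = (\<Sum>t\<in>(\<lambda>m. m\<^sup>2) ` {1..s}. divisor_sum \<phi> t * of_bool (coprime t N) / sqrt t)"
      by (subst sum.reindex) (auto simp: inj_on_def)
    also have "\<dots> \<le> (\<Sum>t=1..s\<^sup>2. divisor_sum \<phi> t * of_bool (coprime t N) / sqrt t)"
      using divisor_sum_nonneg[OF \<phi>] by (intro sum_mono2) (auto simp: power_mono Suc_le_eq)
    finally show ?thesis by (simp add: S_def \<Psi>_def)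
  qed
  obtain s where "(\<Sum>m=1..s. of_bool (coprime m N) / real m) > card (Pow I - {{}}) * C"
    using coprime_harmonic_unbounded[OF N] by blast
  then show False using main[of s] upper[of s] by linarith
qed

section \<open>Quadratic residues and the three-square theorem\<close>

lemma Legendre_cases: "Legendre a p = 0 \<or> Legendre a p = 1 \<or> Legendre a p = -1"
  by (auto simp: Legendre_def)

lemma Legendre_eq_0_iff: "Legendre a p = 0 \<longleftrightarrow> p dvd a"
  by (auto simp: Legendre_def cong_0_iff)

lemma Legendre_cong:
  assumes "[a = b] (mod p)"
  shows "Legendre a p = Legendre b p"
proof -
  have "[y\<^sup>2 = a] (mod p) \<longleftrightarrow> [y\<^sup>2 = b] (mod p)" for y using assms by (auto simp: cong_def)
  moreover have "[a = 0] (mod p) \<longleftrightarrow> [b = 0] (mod p)" using assms by (auto simp: cong_def)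
  ultimately show ?thesis by (simp add: Legendre_def QuadRes_def)
qed

lemma Legendre_eq_1_imp_square:
  assumes "Legendre a p = 1"
  shows "\<exists>y. p dvd y\<^sup>2 - a"
  using assms by (auto simp: Legendre_def QuadRes_def cong_iff_dvd_diff split: if_splits)

lemma odd_prime_gt_2: "prime (p :: nat) \<Longrightarrow> odd p \<Longrightarrow> 2 < p"
  using prime_gt_1_nat[of p] by (cases "p = 2") auto

lemma small_cong_imp_eq:
  fixes a b :: int and p :: nat
  assumes "[a = b] (mod p)" "p > 2" "a \<in> {-1, 0, 1}" "b \<in> {-1, 0, 1}"
  shows "a = b"
proof -
  have "int p dvd a - b" using assms(1) by (simp add: cong_iff_dvd_diff)
  moreover have "\<bar>a - b\<bar> < int p" using assms(2-4) by auto
  ultimately show ?thesis using zdvd_not_zless[of "\<bar>a - b\<bar>" "int p"] by fastforce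
qed

lemma Legendre_mult:
  assumes "prime p" "odd p"
  shows "Legendre (a * b) (int p) = Legendre a (int p) * Legendre b (int p)"
proof (rule small_cong_imp_eq)
  note ec = euler_criterion[OF assms(1) odd_prime_gt_2[OF assms]]
  have "[Legendre a (int p) * Legendre b (int p) = a ^ ((p - 1) div 2) * b ^ ((p - 1) div 2)] (mod p)"
    by (intro cong_mult ec)
  then show "[Legendre (a * b) (int p) = Legendre a (int p) * Legendre b (int p)] (mod p)"
    using ec[of "a * b"] by (metis cong_sym cong_trans power_mult_distrib)
  show "Legendre a (int p) * Legendre b (int p) \<in> {-1, 0, 1}"
    using Legendre_cases[of a p] Legendre_cases[of b p] by auto
qed (use Legendre_cases[of "a * b" p] odd_prime_gt_2[OF assms] in auto)

lemma Legendre_1: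
  assumes "prime p" "odd p"
  shows "Legendre 1 (int p) = 1"
proof -
  have "\<not> int p dvd 1" using odd_prime_gt_2[OF assms] by auto
  then show ?thesis
    using Legendre_mult[OF assms, of 1 1] Legendre_cases[of 1 p] Legendre_eq_0_iff[of 1 p] by auto
qed

lemma Legendre_prod:
  assumes "prime p" "odd p"
  shows "Legendre (\<Prod>x\<in>X. f x) (int p) = (\<Prod>x\<in>X. Legendre (f x) (int p))"
  by (induction X rule: infinite_finite_induct) (simp_all add: Legendre_1[OF assms] Legendre_mult[OF assms])

text \<open>A primitive root has order \<open>p - 1\<close>, so by Euler's criterion it is a
  nonresidue.\<close>

lemma Legendre_nonresidue_exists:
  assumes "prime p" "odd p"
  obtains r :: nat where "Legendre (int r) (int p) = -1"
proof -
  have p: "p > 2" by (rule odd_prime_gt_2[OF assms])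
  have "\<exists>g. residue_primroot p g" using p assms(1) by (intro prime_primitive_root_exists) auto
  then obtain g where g: "residue_primroot p g" by blast
  then have co: "coprime p g" and ord: "ord p g = p - 1"
    using assms by (auto simp: residue_primroot_def totient_prime)
  have "\<not> [g ^ ((p - 1) div 2) = 1] (mod p)"
  proof
    assume "[g ^ ((p - 1) div 2) = 1] (mod p)"
    then have "p - 1 dvd (p - 1) div 2" using ord_divides[of g "(p - 1) div 2" p] ord by simp
    then show False using p by (auto dest!: dvd_imp_le)
  qed
  then have "\<not> [int g ^ ((p - 1) div 2) = 1] (mod int p)"
    by (metis cong_int_iff of_nat_1 of_nat_power)
  then have "Legendre (int g) (int p) \<noteq> 1"
    using euler_criterion[OF assms(1) p, of "int g"] cong_sym by metis
  moreover have "Legendre (int g) (int p) \<noteq> 0"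
    unfolding Legendre_eq_0_iff using co assms(1)
    by (metis coprime_absorb_left int_dvd_int_iff not_prime_unit)
  ultimately show thesis using that Legendre_cases by blast
qed

text \<open>On odd \<open>n\<close>, \<open>sign4\<close> and \<open>sign8\<close> are the Jacobi
  symbols (-1/n) and (2/n). Their value -1 at even \<open>n\<close> is a mere default, so
  multiplicativity is confined to odd arguments.\<close>

definition sign4 :: "nat \<Rightarrow> int" where
  "sign4 n = (if n mod 4 = 1 then 1 else -1)"

definition sign8 :: "nat \<Rightarrow> int" where
  "sign8 n = (if n mod 8 = 1 \<or> n mod 8 = 7 then 1 else -1)"

lemma sign4_mult:
  assumes "odd a" "odd b"
  shows "sign4 (a * b) = sign4 a * sign4 b"
proof -
  have "a mod 4 = 1 \<or> a mod 4 = 3" "b mod 4 = 1 \<or> b mod 4 = 3" using assms by presburger+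
  moreover have "a * b mod 4 = (a mod 4) * (b mod 4) mod 4" by (simp add: mod_mult_eq)
  ultimately show ?thesis unfolding sign4_def by auto
qed

lemma sign8_mult:
  assumes "odd a" "odd b"
  shows "sign8 (a * b) = sign8 a * sign8 b"
proof -
  have "a mod 8 = 1 \<or> a mod 8 = 3 \<or> a mod 8 = 5 \<or> a mod 8 = 7"
    "b mod 8 = 1 \<or> b mod 8 = 3 \<or> b mod 8 = 5 \<or> b mod 8 = 7" using assms by presburger+
  moreover have "a * b mod 8 = (a mod 8) * (b mod 8) mod 8" by (simp add: mod_mult_eq)
  ultimately show ?thesis unfolding sign8_def by auto
qed

lemma odd_prod:
  fixes f :: "'a \<Rightarrow> nat"
  assumes "\<And>x. x \<in> X \<Longrightarrow> odd (f x)"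
  shows "odd (\<Prod>x\<in>X. f x)"
  using assms by (induction X rule: infinite_finite_induct) auto

lemma sign4_prod: "(\<And>x. x \<in> X \<Longrightarrow> odd (f x)) \<Longrightarrow> sign4 (\<Prod>x\<in>X. f x) = (\<Prod>x\<in>X. sign4 (f x))"
proof (induction X rule: infinite_finite_induct)
  case (insert x X)
  then show ?case using sign4_mult[of "f x" "prod f X"] odd_prod[of X f] by auto
qed (simp_all add: sign4_def)

lemma sign8_prod: "(\<And>x. x \<in> X \<Longrightarrow> odd (f x)) \<Longrightarrow> sign8 (\<Prod>x\<in>X. f x) = (\<Prod>x\<in>X. sign8 (f x))"
proof (induction X rule: infinite_finite_induct)
  case (insert x X)
  then show ?case using sign8_mult[of "f x" "prod f X"] odd_prod[of X f] by auto
qed (simp_all add: sign8_def)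

lemma sign4_eq_power:
  assumes "odd n"
  shows "sign4 n = (-1) ^ ((n - 1) div 2)"
proof -
  have "n mod 4 = 1 \<longleftrightarrow> even ((n - 1) div 2)" using assms by presburger
  then show ?thesis by (simp add: sign4_def)
qed

lemma Legendre_minus_1:
  assumes "prime p" "odd p"
  shows "Legendre (-1) (int p) = sign4 p"
proof (rule small_cong_imp_eq)
  show "[Legendre (-1) (int p) = sign4 p] (mod int p)"
    unfolding sign4_eq_power[OF assms(2)] by (rule euler_criterion[OF assms(1) odd_prime_gt_2[OF assms]])
qed (use odd_prime_gt_2[OF assms] Legendre_cases[of "-1" p] in \<open>auto simp: sign4_def\<close>)

text \<open>Gauss's lemma: with \<open>p = 2 * h + 1\<close>, the doubles of 1, ...,
  \<open>h\<close> stay below \<open>p\<close>, so it remains to count those exceeding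
  \<open>h\<close>.\<close>

lemma Legendre_2:
  assumes "prime p" "odd p"
  shows "Legendre 2 (int p) = sign8 p"
proof -
  have p2: "p > 2" by (rule odd_prime_gt_2[OF assms])
  have nd: "[2 \<noteq> 0] (mod int p)" using p2 by (auto simp: cong_0_iff dest: zdvd_imp_le)
  interpret GAUSS p 2 by unfold_locales (use assms p2 nd in auto)
  define h where "h = (int p - 1) div 2"
  have ph: "int p = 2 * h + 1" "h > 0" using p_eq2 p2 by (auto simp: h_def)
  have mod: "x * 2 mod int p = 2 * x" if "x \<in> A" for x
    using that ph by (auto simp: A_def h_def[symmetric] intro!: mod_pos_pos_trivial)
  have C: "C = (\<lambda>x. 2 * x) ` A" unfolding C_def B_def image_image using mod by (intro image_cong) auto
  have "E = (\<lambda>x. 2 * x) ` {h div 2<..h}"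
    unfolding E_def C unfolding A_def h_def[symmetric] by auto
  then have "card E = card {h div 2<..h}" by (simp add: card_image inj_on_def)
  then have card: "card E = nat (h - h div 2)" by simp
  have "even (nat (h - h div 2)) \<longleftrightarrow> even (h - h div 2)" using ph(2) by (simp add: even_nat_iff)
  also have "\<dots> \<longleftrightarrow> int p mod 8 = 1 \<or> int p mod 8 = 7" unfolding ph(1) by presburger
  also have "\<dots> \<longleftrightarrow> p mod 8 = 1 \<or> p mod 8 = 7"
    using of_nat_mod[of p 8, where 'a = int] by simp linarith
  finally show ?thesis using gauss_lemma card by (simp add: sign8_def)
qed

text \<open>The conditional equals the usual power of -1; in this shape its product over many
  \<open>p\<close> can be evaluated by \<open>prod_if_sign4\<close>.\<close>

lemma Legendre_reciprocity:
  assumes "prime p" "odd p" "prime q" "odd q" "p \<noteq> q"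
  shows "Legendre (int p) (int q) = Legendre (int q) (int p) * (if sign4 p = 1 then 1 else sign4 q)"
proof -
  have "\<not> int p dvd int q" using assms primes_dvd_imp_eq[of p q] by auto
  then have sq: "Legendre (int q) (int p) * Legendre (int q) (int p) = 1"
    using Legendre_cases[of q p] Legendre_eq_0_iff[of q p] by auto
  have "Legendre (int p) (int q) * Legendre (int q) (int p) = (-1) ^ ((p - 1) div 2 * ((q - 1) div 2))"
    using Quadratic_Reciprocity assms odd_prime_gt_2 by blast
  also have "\<dots> = (sign4 p) ^ ((q - 1) div 2)" by (simp add: power_mult sign4_eq_power[OF assms(2)])
  also have "\<dots> = (if sign4 p = 1 then 1 else sign4 q)"
    using sign4_eq_power[OF assms(4)] by (auto simp: sign4_def)
  finally have *: "Legendre (int p) (int q) * Legendre (int q) (int p) = (if sign4 p = 1 then 1 else sign4 q)" .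
  have "Legendre (int p) (int q) = Legendre (int p) (int q) * (Legendre (int q) (int p) * Legendre (int q) (int p))"
    unfolding sq by simp
  also have "\<dots> = (if sign4 p = 1 then 1 else sign4 q) * Legendre (int q) (int p)"
    unfolding mult.assoc[symmetric] * ..
  finally show ?thesis by (simp only: mult.commute)
qed

lemma prod_if_sign4:
  assumes "\<And>p. p \<in> P \<Longrightarrow> odd p" "c * c = (1 :: int)"
  shows "(\<Prod>p\<in>P. if sign4 p = 1 then 1 else c) = (if sign4 (\<Prod>P) = 1 then 1 else c)"
  using assms(1)
proof (induction P rule: infinite_finite_induct)
  case (insert p P)
  have "sign4 (p * \<Prod>P) = sign4 p * sign4 (\<Prod>P)"
    using insert odd_prod[of P "\<lambda>x. x"] by (intro sign4_mult) auto
  moreover have "sign4 p = 1 \<or> sign4 p = -1" "sign4 (\<Prod>P) = 1 \<or> sign4 (\<Prod>P) = -1" by (auto simp: sign4_def)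
  ultimately show ?case using insert assms(2) by auto
qed (simp_all add: sign4_def)

text \<open>Chinese remaindering one prime at a time; squarefreeness keeps the split-off prime
  coprime to the cofactor.\<close>

lemma square_root_mod_squarefree:
  fixes k :: nat and c :: int
  assumes "squarefree k" "\<And>p. prime p \<Longrightarrow> p dvd k \<Longrightarrow> \<exists>x. int p dvd x\<^sup>2 + c"
  shows "\<exists>x. int k dvd x\<^sup>2 + c"
  using assms
proof (induction k rule: less_induct)
  case (less k)
  have k0: "k > 0" using less(2) by (intro Nat.gr0I) auto
  show ?case
  proof (cases "k = 1")
    case False
    then obtain p where p: "prime p" "p dvd k" using prime_factor_nat by blast
    then obtain k' where k': "k = p * k'" by auto
    have "k' > 0" using k0 k' by simp
    then have "k' < k" using p prime_gt_1_nat[OF p(1)] k' by simp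
    moreover have "squarefree k'" using less(2) k' squarefree_mono[of k' k] by simp
    ultimately obtain y where y: "int k' dvd y\<^sup>2 + c" using less k' by (metis dvd_mult)
    obtain x where x: "int p dvd x\<^sup>2 + c" using less(3) p by blast
    have "\<not> p dvd k'"
    proof
      assume "p dvd k'"
      then have "p\<^sup>2 dvd k" by (simp add: k' power2_eq_square)
      then have "p dvd 1" using squarefreeD[OF less(2)] by blast
      then show False using p(1) by auto
    qed
    then have co: "coprime (int p) (int k')" using p(1) by (simp add: prime_imp_coprime)
    obtain z where z: "[z = x] (mod int p)" "[z = y] (mod int k')"
      using binary_chinese_remainder_int[OF co] by blast
    have "[z\<^sup>2 + c = x\<^sup>2 + c] (mod int p)" "[z\<^sup>2 + c = y\<^sup>2 + c] (mod int k')"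
      using z by (auto intro!: cong_add cong_pow)
    then have "int p dvd z\<^sup>2 + c" "int k' dvd z\<^sup>2 + c" using x y by (auto simp: cong_dvd_iff)
    then have "int p * int k' dvd z\<^sup>2 + c" using co by (intro divides_mult)
    then show ?thesis using k' by auto
  qed simp
qed

lemma coprime_8_prod_iff:
  assumes "finite P" "\<And>p. p \<in> P \<Longrightarrow> prime p"
  shows "coprime t (8 * \<Prod>P) \<longleftrightarrow> odd t \<and> (\<forall>p\<in>P. \<not> p dvd (t :: nat))"
proof -
  have "coprime t 8 \<longleftrightarrow> odd t"
    using coprime_power_right_iff[of t 2 3] by (simp add: coprime_right_2_iff_odd)
  moreover have "coprime t (\<Prod>P) \<longleftrightarrow> (\<forall>p\<in>P. \<not> p dvd t)"
    using assms
  proof (induction P rule: finite_induct)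
    case (insert p P)
    have "coprime t p \<longleftrightarrow> \<not> p dvd t"
      using insert(4)[of p] by (metis coprime_absorb_left coprime_commute insertI1 not_prime_unit prime_imp_coprime)
    then show ?case using insert by (simp add: coprime_mult_right_iff)
  qed simp
  ultimately show ?thesis by (simp add: coprime_mult_right_iff)
qed

text \<open>The mask turns a function multiplicative only on arguments prime to \<open>N\<close>,
  such as one built from \<open>sign4\<close>, into a character.\<close>

lemma real_character_of_int:
  assumes "N > 0" "\<And>a b. coprime a N \<Longrightarrow> coprime b N \<Longrightarrow> g (a * b) = g a * g b" "\<And>t. g (t + N) = g t"
    "\<And>t. coprime t N \<Longrightarrow> g t = 1 \<or> g t = -1"
  shows "real_character N (\<lambda>t. of_bool (coprime t N) * of_int (g t))"
proof (rule real_characterI)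
  fix a b
  show "of_bool (coprime (a * b) N) * real_of_int (g (a * b))
      = of_bool (coprime a N) * of_int (g a) * (of_bool (coprime b N) * of_int (g b))"
    using assms(2)[of a b] by (auto simp: coprime_mult_left_iff)
next
  fix t
  show "coprime t N \<Longrightarrow> of_bool (coprime t N) * real_of_int (g t) = 1 \<or> of_bool (coprime t N) * real_of_int (g t) = -1"
    using assms(4)[of t] by auto
qed (use assms in \<open>auto simp: coprime_add_self_nat\<close>)

text \<open>For squarefree \<open>n\<close> with odd part \<open>m\<close> and \<open>ev \<longleftrightarrow> even n\<close>, quadratic reciprocity turns the
  Kronecker symbol \<open>(-n/t)\<close> into \<open>(t/m)\<close> times this factor.\<close>

definition kronecker_factor :: "bool \<Rightarrow> nat \<Rightarrow> nat \<Rightarrow> int" where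
  "kronecker_factor ev m t = (if sign4 m = 1 then sign4 t else 1) * (if ev then sign8 t else 1)"

lemma kronecker_factor_mult:
  "odd a \<Longrightarrow> odd b \<Longrightarrow> kronecker_factor ev m (a * b) = kronecker_factor ev m a * kronecker_factor ev m b"
  by (simp add: kronecker_factor_def sign4_mult sign8_mult)

lemma kronecker_factor_cases: "kronecker_factor ev m t = 1 \<or> kronecker_factor ev m t = -1"
  by (simp add: kronecker_factor_def sign4_def sign8_def)

lemma sign_cong_8:
  assumes "a mod 8 = b mod 8"
  shows "sign4 a = sign4 b" "sign8 a = sign8 b"
proof -
  have "a mod 4 = b mod 4" using assms mod_mod_cancel[of 4 8 a] mod_mod_cancel[of 4 8 b] by simp
  then show "sign4 a = sign4 b" by (simp add: sign4_def)
  show "sign8 a = sign8 b" using assms by (simp add: sign8_def)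
qed

lemma kronecker_factor_cong_8:
  assumes "a mod 8 = b mod 8"
  shows "kronecker_factor ev m a = kronecker_factor ev m b"
  by (simp add: kronecker_factor_def sign_cong_8[OF assms])

text \<open>The factor -1 contributes \<open>sign4 r\<close>, and reciprocity contributes another
  \<open>sign4 r\<close> exactly when \<open>sign4 (\<Prod>P)\<close> is not 1. The two then cancel,
  as \<open>kronecker_factor\<close> records.\<close>

lemma Legendre_minus_prod:
  assumes P: "finite P" "\<And>p. p \<in> P \<Longrightarrow> prime p \<and> odd p" and r: "prime r" "odd r" "r \<notin> P"
  shows "Legendre (- int ((if ev then 2 else 1) * \<Prod>P)) (int r)
    = kronecker_factor ev (\<Prod>P) r * (\<Prod>p\<in>P. Legendre (int r) (int p))"
proof -
  have eq: "- int ((if ev then 2 else 1) * \<Prod>P) = (-1) * ((if ev then 2 else 1) * (\<Prod>p\<in>P. int p))"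
    by simp
  have "(\<Prod>p\<in>P. Legendre (int p) (int r)) = (\<Prod>p\<in>P. Legendre (int r) (int p) * (if sign4 p = 1 then 1 else sign4 r))"
    using P r by (intro prod.cong Legendre_reciprocity) auto
  also have "\<dots> = (\<Prod>p\<in>P. Legendre (int r) (int p)) * (if sign4 (\<Prod>P) = 1 then 1 else sign4 r)"
    using P by (subst prod.distrib, subst prod_if_sign4) (auto simp: sign4_def)
  finally have 1: "(\<Prod>p\<in>P. Legendre (int p) (int r)) = \<dots>" .
  have "sign4 r * sign4 r = 1" by (simp add: sign4_def)
  then show ?thesis
    unfolding eq Legendre_mult[OF r(1,2)] Legendre_prod[OF r(1,2)] 1 Legendre_minus_1[OF r(1,2)]
    by (simp add: Legendre_2[OF r(1,2)] Legendre_1[OF r(1,2)] kronecker_factor_def mult_ac)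
qed

text \<open>Chinese remaindering with a nonresidue at \<open>p\<close> and 1 elsewhere; it makes the
  symbols at different primes independent.\<close>

lemma exists_separating_residue:
  assumes P: "finite P" "\<And>p. p \<in> P \<Longrightarrow> prime p \<and> odd p" and p: "p \<in> P"
  obtains a :: nat where "coprime a (8 * \<Prod>P)" "a mod 8 = 1" "Legendre (int a) (int p) = -1"
    "\<And>q. q \<in> P \<Longrightarrow> q \<noteq> p \<Longrightarrow> Legendre (int a) (int q) = 1"
proof -
  obtain r :: nat where r: "Legendre (int r) (int p) = -1" using Legendre_nonresidue_exists P(2)[OF p] by blast
  have "coprime p (8 * \<Prod>(P - {p}))"
    using P p primes_dvd_imp_eq[of _ p] by (subst coprime_8_prod_iff) auto
  then obtain a where a: "[a = r] (mod p)" "[a = 1] (mod 8 * \<Prod>(P - {p}))"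
    using binary_chinese_remainder_nat by blast
  have 1: "Legendre (int a) (int p) = -1" using a(1) r Legendre_cong[of "int a" "int r" "int p"] by (simp add: cong_int_iff)
  have 2: "Legendre (int a) (int q) = 1" if q: "q \<in> P" "q \<noteq> p" for q
  proof -
    have "q dvd \<Prod>(P - {p})" using q P(1) by (intro dvd_prodI[of _ _ "\<lambda>x. x"]) auto
    then have "[a = 1] (mod q)" using a(2) cong_dvd_modulus_nat by (meson dvd_mult)
    then have "Legendre (int a) (int q) = Legendre 1 (int q)" by (intro Legendre_cong) (metis cong_int_iff of_nat_1)
    then show ?thesis using Legendre_1 P(2)[OF q(1)] by simp
  qed
  have 8: "a mod 8 = 1" using cong_dvd_modulus_nat[OF a(2), of 8] by (simp add: cong_def)
  have "odd a" using 8 by presburger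
  moreover have "\<not> q dvd a" if "q \<in> P" for q
    using 1 2[OF that] Legendre_eq_0_iff[of "int a" "int q"] by (cases "q = p") auto
  ultimately have "coprime a (8 * \<Prod>P)" using P by (subst coprime_8_prod_iff) auto
  then show thesis using that 8 1 2 by blast
qed

lemma exists_residue_mod_8:
  fixes c :: nat
  assumes P: "finite P" "\<And>p. p \<in> P \<Longrightarrow> prime p \<and> odd p" and c: "odd c"
  obtains a :: nat where "coprime a (8 * \<Prod>P)" "a mod 8 = c mod 8" "\<And>q. q \<in> P \<Longrightarrow> Legendre (int a) (int q) = 1"
proof -
  have "odd (\<Prod>P)" using odd_prod[of P "\<lambda>x. x"] P(2) by auto
  then have "coprime (2 ^ 3) (\<Prod>P)" by (metis coprime_left_2_iff_odd coprime_power_left_iff)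
  then obtain a where a: "[a = c] (mod 2 ^ 3)" "[a = 1] (mod \<Prod>P)"
    using binary_chinese_remainder_nat by blast
  have 2: "Legendre (int a) (int q) = 1" if q: "q \<in> P" for q
  proof -
    have "q dvd \<Prod>P" using q P(1) by (intro dvd_prodI[of _ _ "\<lambda>x. x"]) auto
    then have "[a = 1] (mod q)" using a(2) cong_dvd_modulus_nat by blast
    then have "Legendre (int a) (int q) = Legendre 1 (int q)" by (intro Legendre_cong) (metis cong_int_iff of_nat_1)
    then show ?thesis using Legendre_1 P(2)[OF q(1)] by simp
  qed
  have 8: "a mod 8 = c mod 8" using a(1) by (simp add: cong_def)
  then have "odd a" using c by presburger
  moreover have "\<not> q dvd a" if "q \<in> P" for q
    using 2[OF that] Legendre_eq_0_iff[of "int a" "int q"] by auto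
  ultimately have "coprime a (8 * \<Prod>P)" using P by (subst coprime_8_prod_iff) auto
  then show thesis using that 8 2 by blast
qed

text \<open>The last conclusion says that the symbol of \<open>- n\<close> is 1 at each prime
  \<open>r\<close> of \<open>t\<close>. For odd \<open>\<Prod>P\<close> that is 3 modulo 4 and
  \<open>ev\<close> false, that symbol is the product of all prescribed ones, whence the
  compatibility condition.\<close>

lemma exists_squarefree_prescribed_symbols:
  assumes P: "finite P" "\<And>p. p \<in> P \<Longrightarrow> prime p \<and> odd p"
    and \<epsilon>: "\<And>p. p \<in> P \<Longrightarrow> \<epsilon> p = 1 \<or> \<epsilon> p = (-1 :: int)"
    and compat: "\<not> ev \<Longrightarrow> sign4 (\<Prod>P) \<noteq> 1 \<Longrightarrow> (\<Prod>p\<in>P. \<epsilon> p) = 1"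
  obtains t where "t > 0" "squarefree t" "coprime t (8 * \<Prod>P)"
    "\<And>p. p \<in> P \<Longrightarrow> Legendre (int t) (int p) = \<epsilon> p"
    "\<And>r. prime r \<Longrightarrow> r dvd t \<Longrightarrow> kronecker_factor ev (\<Prod>P) r * (\<Prod>p\<in>P. Legendre (int r) (int p)) = 1"
proof -
  define m where "m = \<Prod>P"
  define N where "N = 8 * m"
  have "m \<noteq> 0" unfolding m_def using P by (auto simp: prod_zero_iff)
  then have N0: "N > 0" by (simp add: N_def)
  have copr: "coprime t N \<longleftrightarrow> odd t \<and> (\<forall>p\<in>P. \<not> p dvd t)" for t
    unfolding N_def m_def using P by (intro coprime_8_prod_iff) auto
  have Leg: "Legendre (int t) (int p) = 1 \<or> Legendre (int t) (int p) = -1" if "coprime t N" "p \<in> P" for t p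
    using that Legendre_cases[of "int t" "int p"] Legendre_eq_0_iff[of "int t" "int p"] by (auto simp: copr)
  have Legper: "Legendre (int (t + N)) (int p) = Legendre (int t) (int p)" if "p \<in> P" for t p
  proof (rule Legendre_cong)
    have "p dvd N" unfolding N_def m_def using that P(1) dvd_prodI[of P p "\<lambda>x. x"] by simp
    then show "[int (t + N) = int t] (mod int p)" by (simp add: cong_iff_dvd_diff)
  qed
  have Legm: "Legendre (int (a * b)) (int p) = Legendre (int a) (int p) * Legendre (int b) (int p)" if "p \<in> P" for a b p
    using Legendre_mult[of p "int a" "int b"] P(2)[OF that] by simp
  define g where "g t = kronecker_factor ev m t * (\<Prod>p\<in>P. Legendre (int t) (int p))" for t
  define \<phi> where "\<phi> t = of_bool (coprime t N) * real_of_int (g t)" for t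
  define \<psi> where "\<psi> p t = of_bool (coprime t N) * real_of_int (Legendre (int t) (int p))" for p t
  have \<phi>: "real_character N \<phi>" unfolding \<phi>_def
  proof (rule real_character_of_int[OF N0])
    show "g (a * b) = g a * g b" if "coprime a N" "coprime b N" for a b
      unfolding g_def using that copr by (simp add: kronecker_factor_mult Legm prod.distrib del: of_nat_mult)
    show "g (t + N) = g t" for t
      unfolding g_def using Legper kronecker_factor_cong_8[of "t + N" t] by (simp add: N_def del: of_nat_add)
    show "g t = 1 \<or> g t = -1" if "coprime t N" for t
    proof -
      have "\<bar>\<Prod>p\<in>P. Legendre (int t) (int p)\<bar> = 1"
        unfolding abs_prod using Leg[OF that] by (intro prod.neutral) fastforce
      then have "\<bar>g t\<bar> = 1" using kronecker_factor_cases[of ev m t] by (auto simp: g_def abs_mult)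
      then show ?thesis by linarith
    qed
  qed
  have \<psi>: "real_character N (\<psi> p)" if "p \<in> P" for p
    unfolding \<psi>_def using that by (intro real_character_of_int[OF N0]) (auto simp: Legm Legper Leg simp del: of_nat_mult of_nat_add)
  have \<psi>c: "\<psi> p a = real_of_int (Legendre (int a) (int p))" if "coprime a N" for p a
    using that by (simp add: \<psi>_def)
  \<comment> \<open>A residue nontrivial only at \<open>p\<close> gives -1 to \<open>\<phi>\<close>
    and to every product containing \<open>p\<close>, and 1 to all other products.\<close>
  have sep: "\<exists>a. coprime a N \<and> (\<forall>J\<subseteq>P. (\<Prod>j\<in>J. \<psi> j a) = (if p \<in> J then -1 else 1)) \<and> \<phi> a = -1" if p: "p \<in> P" for p
  proof -
    obtain a where a: "coprime a (8 * \<Prod>P)" "a mod 8 = 1" "Legendre (int a) (int p) = -1"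
      "\<And>q. q \<in> P \<Longrightarrow> q \<noteq> p \<Longrightarrow> Legendre (int a) (int q) = 1"
      using exists_separating_residue[OF P p] by blast
    have co: "coprime a N" using a(1) by (simp add: N_def m_def)
    have pr: "(\<Prod>j\<in>J. real_of_int (Legendre (int a) (int j))) = (if p \<in> J then -1 else 1)" if J: "J \<subseteq> P" for J
    proof -
      have "finite J" using J P(1) finite_subset by blast
      have "(\<Prod>j\<in>J - {p}. real_of_int (Legendre (int a) (int j))) = 1" using a(4) J by (intro prod.neutral) auto
      then show ?thesis using a(3) \<open>finite J\<close> by (cases "p \<in> J") (auto simp: prod.remove[of J p])
    qed
    moreover have "kronecker_factor ev m a = 1"
      using kronecker_factor_cong_8[of a 1 ev m] a(2) by (simp add: kronecker_factor_def sign4_def sign8_def)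
    ultimately have "\<phi> a = -1" unfolding \<phi>_def g_def using co pr[of P] p by simp
    then show ?thesis using co pr \<psi>c[OF co] by auto
  qed
  have "\<exists>t>0. coprime t N \<and> divisor_sum \<phi> t > 0 \<and> (\<forall>j\<in>P. \<psi> j t = real_of_int (\<epsilon> j))"
  proof (rule exists_prescribed_characters[OF \<phi> P(1) \<psi>])
    show "real_of_int (\<epsilon> j) = 1 \<or> real_of_int (\<epsilon> j) = -1" if "j \<in> P" for j using \<epsilon>[OF that] by auto
  next
    fix J assume J: "J \<subseteq> P" "J \<noteq> {}"
    then obtain p where "p \<in> J" "p \<in> P" by blast
    then show "\<exists>a. coprime a N \<and> (\<Prod>j\<in>J. \<psi> j a) = -1" using sep[of p] J(1) by auto
    show "(\<exists>a. coprime a N \<and> \<phi> a * (\<Prod>j\<in>J. \<psi> j a) = -1) \<or>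
      ((\<forall>a. coprime a N \<longrightarrow> \<phi> a = (\<Prod>j\<in>J. \<psi> j a)) \<and> (\<Prod>j\<in>J. real_of_int (\<epsilon> j)) = 1)"
    proof (cases "J = P")
      case False
      then obtain p where p: "p \<in> P" "p \<notin> J" using J by blast
      then obtain a where "coprime a N" "\<phi> a = -1" "(\<Prod>j\<in>J. \<psi> j a) = 1"
        using sep[OF p(1)] J(1) by auto
      then show ?thesis by auto
    next
      case True
      show ?thesis
      proof (cases "ev \<or> sign4 m = 1")
        case nontriv: True
        \<comment> \<open>7 has \<open>sign4\<close> equal to -1 and \<open>sign8\<close> equal to
          1, while 5 has the opposite signs; so the Kronecker factor is -1 in either case.\<close>
        define c :: nat where "c = (if sign4 m = 1 then 7 else 5)"
        have "odd c" by (simp add: c_def)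
        then obtain a where a: "coprime a (8 * \<Prod>P)" "a mod 8 = c mod 8" "\<And>q. q \<in> P \<Longrightarrow> Legendre (int a) (int q) = 1"
          using exists_residue_mod_8[OF P] by blast
        have co: "coprime a N" using a(1) by (simp add: N_def m_def)
        have "kronecker_factor ev m a = kronecker_factor ev m c" by (rule kronecker_factor_cong_8[OF a(2)])
        also have "\<dots> = -1" using nontriv by (auto simp: kronecker_factor_def c_def) (simp_all add: sign4_def sign8_def)
        finally have "\<phi> a = -1" using co a(3) by (simp add: \<phi>_def g_def)
        moreover have "(\<Prod>j\<in>J. \<psi> j a) = 1" using a(3) True \<psi>c[OF co] by simp
        ultimately show ?thesis using co by auto
      next
        \<comment> \<open>Here \<open>\<phi>\<close> coincides with the product of all symbols, and
          \<open>compat\<close> supplies the sign.\<close>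
        case triv: False
        then have "\<phi> a = (\<Prod>j\<in>J. \<psi> j a)" if "coprime a N" for a
          using that True by (simp add: \<phi>_def g_def kronecker_factor_def \<psi>_def)
        moreover have "(\<Prod>j\<in>J. real_of_int (\<epsilon> j)) = 1"
          using compat triv True by (simp add: m_def flip: of_int_prod)
        ultimately show ?thesis by blast
      qed
    qed
  qed
  then obtain t where t: "t > 0" "coprime t N" "divisor_sum \<phi> t > 0" "\<And>j. j \<in> P \<Longrightarrow> \<psi> j t = real_of_int (\<epsilon> j)"
    by blast
  \<comment> \<open>Dropping the square part preserves the symbols at \<open>P\<close>, and each
    prime of \<open>t0\<close> has odd multiplicity in \<open>t\<close>, so its character value is
    1.\<close>
  define t0 s where "t0 = squarefree_part t" and "s = square_part t"
  have ts: "t = t0 * s\<^sup>2" unfolding t0_def s_def by (rule squarefree_decompose)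
  have t0: "t0 > 0" using t(1) ts by (intro Nat.gr0I) auto
  have co: "coprime t0 N" "coprime s N" using t(2) t(1) unfolding ts by (auto simp: power2_eq_square)
  show thesis
  proof (rule that)
    show "t0 > 0" by (rule t0)
    show "squarefree t0" by (simp add: t0_def)
    show "coprime t0 (8 * \<Prod>P)" using co(1) unfolding N_def m_def .
    show "Legendre (int t0) (int p) = \<epsilon> p" if p: "p \<in> P" for p
    proof -
      have "real_of_int (Legendre (int t) (int p)) = real_of_int (\<epsilon> p)" using t(4)[OF p] \<psi>c[OF t(2)] by simp
      moreover have "Legendre (int t) (int p) = Legendre (int t0) (int p) * (Legendre (int s) (int p) * Legendre (int s) (int p))"
        unfolding ts power2_eq_square Legm[OF p] ..
      ultimately show ?thesis using Leg[OF co(2) p] by auto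
    qed
    show "kronecker_factor ev (\<Prod>P) r * (\<Prod>p\<in>P. Legendre (int r) (int p)) = 1" if r: "prime r" "r dvd t0" for r
    proof -
      have "coprime r N" by (rule coprime_divisors[OF r(2) dvd_refl co(1)])
      moreover have "multiplicity r t0 \<noteq> 0"
        using r t0 by (simp add: prime_multiplicity_gt_zero_iff not_dvd_imp_multiplicity_0 multiplicity_eq_zero_iff)
      then have "odd (multiplicity r t)"
        using prime_multiplicity_squarefree_part[OF r(1), of t] unfolding t0_def by (metis even_iff_mod_2_eq_zero)
      ultimately have "\<phi> r = 1"
        using divisor_sum_nonzero_imp_character_one[OF \<phi> _ t(1) r(1)] t(3) by simp
      then have "real_of_int (g r) = 1" using \<open>coprime r N\<close> by (simp add: \<phi>_def)
      then have "g r = 1" by (simp only: of_int_eq_1_iff)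
      then show ?thesis by (simp add: g_def m_def)
    qed
  qed
qed

section \<open>Squarefree numbers as sums of three squares\<close>

lemma squarefree_eq_prod_odd_primes:
  fixes n :: nat
  assumes "squarefree n"
  shows "n = (if even n then 2 else 1) * \<Prod>{p. prime p \<and> odd p \<and> p dvd n}"
proof -
  define P where "P = {p. prime p \<and> odd p \<and> p dvd n}"
  have n0: "n \<noteq> 0" using assms by (metis not_squarefree_0)
  have "P \<subseteq> prime_factors n" using n0 by (auto simp: P_def prime_factors_dvd)
  then have fin: "finite P" by (rule finite_subset) simp
  have "n = (\<Prod>p\<in>prime_factors n. p ^ multiplicity p n)"
    using n0 by (simp add: prod_prime_factors)
  also have "\<dots> = \<Prod>(prime_factors n)"
    using assms n0 squarefree_factorial_semiring'[of n] by (intro prod.cong) auto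
  also have "prime_factors n = (if even n then insert 2 P else P)"
    using n0 prime_gt_1_nat by (auto simp: P_def prime_factors_dvd) (metis primes_dvd_imp_eq two_is_prime_nat)+
  also have "\<Prod>\<dots> = (if even n then 2 else 1) * \<Prod>P"
    using fin by (simp add: P_def)
  finally show ?thesis by (simp only: P_def)
qed

lemma squarefree_sum_of_three_squares:
  fixes n :: nat
  assumes n: "squarefree n" "n mod 8 \<noteq> 7"
  shows "sum_of_three_squares (int n)"
proof -
  define P where "P = {p. prime p \<and> odd p \<and> p dvd n}"
  \<comment> \<open>The modulus will be \<open>T = \<tau> * t\<close>. The factor 2 is for
    \<open>n\<close> congruent to 3 modulo 4, where \<open>compat\<close> needs the symbol of
    \<open>- \<tau>\<close> over \<open>n\<close> to be 1 but (-1/n) is -1.\<close>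
  define \<tau> :: nat where "\<tau> = (if n mod 4 = 3 then 2 else 1)"
  have n0: "n > 0" using n(1) by (metis not_squarefree_0 gr0I)
  have fin: "finite P" using n0 by (auto simp: P_def intro: finite_subset[of _ "{..n}"] dvd_imp_le)
  have P: "\<And>p. p \<in> P \<Longrightarrow> prime p \<and> odd p" by (auto simp: P_def)
  have nP: "n = (if even n then 2 else 1) * \<Prod>P"
    using squarefree_eq_prod_odd_primes[OF n(1)] by (simp only: P_def)
  \<comment> \<open>Prescribing this value for \<open>t\<close> makes the symbol of
    \<open>- T\<close> at \<open>p\<close> equal to
    \<open>\<epsilon> p * \<epsilon> p = 1\<close>.\<close>
  define \<epsilon> where "\<epsilon> p = Legendre (- int \<tau>) (int p)" for p
  have \<epsilon>: "\<epsilon> p = 1 \<or> \<epsilon> p = -1" if "p \<in> P" for p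
  proof -
    have "\<not> p dvd \<tau>" using P[OF that] odd_prime_gt_2[of p] by (auto simp: \<tau>_def dest: dvd_imp_le)
    then have "\<not> int p dvd - int \<tau>" by simp
    then show ?thesis using Legendre_cases[of "- int \<tau>" "int p"] Legendre_eq_0_iff[of "- int \<tau>" "int p"]
      unfolding \<epsilon>_def by blast
  qed
  have compat: "(\<Prod>p\<in>P. \<epsilon> p) = 1" if "\<not> even n" "sign4 (\<Prod>P) \<noteq> 1"
  proof -
    have nn: "n = \<Prod>P" using nP that(1) by simp
    then have "n mod 4 = 3" using that by (simp add: sign4_def split: if_splits) presburger
    \<comment> \<open>The excluded class 7 enters here: (-2/n) is 1 for \<open>n\<close> congruent
      to 3 modulo 8, but -1 for 7.\<close>
    then have n3: "n mod 8 = 3" and \<tau>: "\<tau> = 2" using n(2) by (presburger, simp add: \<tau>_def)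
    have "\<epsilon> p = sign4 p * sign8 p" if "p \<in> P" for p
      using Legendre_mult[of p "-1" 2] Legendre_minus_1[of p] Legendre_2[of p] P[OF that] by (simp add: \<epsilon>_def \<tau>)
    then have "(\<Prod>p\<in>P. \<epsilon> p) = (\<Prod>p\<in>P. sign4 p) * (\<Prod>p\<in>P. sign8 p)" by (simp add: prod.distrib)
    also have "\<dots> = sign4 n * sign8 n"
      unfolding nn using P by (subst sign4_prod[symmetric] , simp, subst sign8_prod[symmetric]) simp_all
    also have "\<dots> = 1" using n3 \<open>n mod 4 = 3\<close> by (simp add: sign4_def sign8_def)
    finally show ?thesis .
  qed
  obtain t where t: "t > 0" "squarefree t" "coprime t (8 * \<Prod>P)"
    "\<And>p. p \<in> P \<Longrightarrow> Legendre (int t) (int p) = \<epsilon> p"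
    "\<And>r. prime r \<Longrightarrow> r dvd t \<Longrightarrow> kronecker_factor (even n) (\<Prod>P) r * (\<Prod>p\<in>P. Legendre (int r) (int p)) = 1"
    using exists_squarefree_prescribed_symbols[OF fin P \<epsilon> compat] by blast
  have t': "odd t" "\<And>p. p \<in> P \<Longrightarrow> \<not> p dvd t" using t(3) coprime_8_prod_iff[OF fin] P by blast+
  define T where "T = \<tau> * t"
  have even_case: "\<exists>x. int 2 dvd x\<^sup>2 + c" for c :: int
    by (intro exI[of _ c]) simp
  have "squarefree T"
  proof -
    have "coprime \<tau> t" using t'(1) by (simp add: \<tau>_def coprime_left_2_iff_odd)
    moreover have "squarefree \<tau>" by (simp add: \<tau>_def squarefree_prime)
    ultimately show ?thesis unfolding T_def using t(2) by (intro squarefree_mult_coprime)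
  qed
  moreover have "\<exists>x. int r dvd x\<^sup>2 + int n" if r: "prime r" "r dvd T" for r
  proof (cases "r = 2")
    case False
    then have rt: "odd r" "r dvd t" using r primes_dvd_imp_eq[of r 2] prime_odd_nat[of r] prime_gt_1_nat[of r]
      by (auto simp: T_def prime_dvd_mult_iff \<tau>_def split: if_splits)
    then have "r \<notin> P" using t'(2) by blast
    have "Legendre (- int n) (int r) = kronecker_factor (even n) (\<Prod>P) r * (\<Prod>p\<in>P. Legendre (int r) (int p))"
      using Legendre_minus_prod[OF fin P r(1) rt(1) \<open>r \<notin> P\<close>, of "even n"] nP by metis
    also have "\<dots> = 1" by (rule t(5)[OF r(1) rt(2)])
    finally show ?thesis using Legendre_eq_1_imp_square by fastforce
  next
    case True
    show ?thesis unfolding True by (rule even_case)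
  qed
  ultimately obtain b where b: "int T dvd b\<^sup>2 + int n" using square_root_mod_squarefree by blast
  have "\<exists>x. int p dvd x\<^sup>2 + int T" if p: "prime p" "p dvd n" for p
  proof (cases "p = 2")
    case False
    then have p': "odd p" using p(1) prime_odd_nat[of p] prime_gt_1_nat[of p] by auto
    then have "p \<in> P" using p by (simp add: P_def)
    have "Legendre (- int T) (int p) = \<epsilon> p * \<epsilon> p"
      using Legendre_mult[OF p(1) p', of "- int \<tau>" "int t"] t(4)[OF \<open>p \<in> P\<close>] by (simp add: T_def \<epsilon>_def)
    then have "Legendre (- int T) (int p) = 1" using \<epsilon>[OF \<open>p \<in> P\<close>] by auto
    then show ?thesis using Legendre_eq_1_imp_square by fastforce
  next
    case True
    show ?thesis unfolding True by (rule even_case)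
  qed
  then obtain B1 where B1: "int n dvd B1\<^sup>2 + int T" using square_root_mod_squarefree[OF n(1)] by blast
  have "coprime T n"
  proof -
    have "coprime t n"
    proof (rule coprime_divisors[OF dvd_refl _ t(3)])
      show "n dvd 8 * \<Prod>P" by (subst nP) (auto intro!: mult_dvd_mono)
    qed
    moreover have "coprime \<tau> n"
    proof -
      have "odd n" if "n mod 4 = 3" using that by presburger
      then show ?thesis by (simp add: \<tau>_def coprime_left_2_iff_odd)
    qed
    ultimately show ?thesis by (simp add: T_def coprime_mult_left_iff)
  qed
  moreover have "T > 0" using t(1) by (simp add: T_def \<tau>_def)
  ultimately show ?thesis
    using sum_of_three_squares_if_quadratic_residues[OF _ _ _ B1 b] n0 by simp
qed

section \<open>The three-square theorem for all nonnegative integers\<close>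

lemma legendre_form_not_sum_of_three_squares:
  assumes "legendre_form m"
  shows "\<not> sum_of_three_squares m"
proof
  assume "sum_of_three_squares m"
  then obtain x y z where xyz: "m = x\<^sup>2 + y\<^sup>2 + z\<^sup>2" by (auto simp: sum_of_three_squares_def)
  obtain a b where "m = 4 ^ a * (8 * int b + 7)" using assms by (auto simp: legendre_form_def)
  then show False using xyz
  proof (induction a arbitrary: m x y z)
    case 0
    have sq: "w\<^sup>2 mod 8 = 0 \<or> w\<^sup>2 mod 8 = 1 \<or> w\<^sup>2 mod 8 = 4" for w :: int
    proof -
      have "w mod 8 \<in> {0, 1, 2, 3, 4, 5, 6, 7}" using pos_mod_bound[of 8 w] pos_mod_sign[of 8 w] by auto
      moreover have "w\<^sup>2 mod 8 = (w mod 8)\<^sup>2 mod 8" by (simp add: power_mod)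
      ultimately show ?thesis by auto
    qed
    have "(x\<^sup>2 + y\<^sup>2 + z\<^sup>2) mod 8 = 7" using 0 by simp
    then show False using sq[of x] sq[of y] sq[of z] by presburger
  next
    case (Suc a)
    have sq: "w\<^sup>2 mod 4 = (if even w then 0 else 1)" for w :: int
    proof (cases "even w")
      case True
      then obtain v where "w = 2 * v" by auto
      then show ?thesis by (simp add: power2_eq_square)
    next
      case False
      then obtain v where "w = 2 * v + 1" by (auto elim: oddE)
      then have "w\<^sup>2 = 1 + 4 * (v\<^sup>2 + v)" by (simp add: power2_eq_square algebra_simps)
      then have "w\<^sup>2 mod 4 = 1 mod 4" by (simp only: mod_mult_self2)
      then show ?thesis using False by simp
    qed
    \<comment> \<open>Squares are 0 or 1 modulo 4, so all three numbers are even and a factor 4 can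
      be removed.\<close>
    have "(x\<^sup>2 + y\<^sup>2 + z\<^sup>2) mod 4 = 0" using Suc.prems by simp
    then have "even x \<and> even y \<and> even z" using sq[of x] sq[of y] sq[of z] by (auto split: if_splits) presburger+
    then obtain x' y' z' where h: "x = 2 * x'" "y = 2 * y'" "z = 2 * z'" by (auto elim!: evenE)
    then have "4 ^ a * (8 * int b + 7) = x'\<^sup>2 + y'\<^sup>2 + z'\<^sup>2"
      using Suc.prems by (simp add: power_mult_distrib)
    then show False using Suc.IH by blast
  qed
qed

theorem three_squares:
  assumes "m \<ge> 0"
  shows "sum_of_three_squares m \<longleftrightarrow> \<not> legendre_form m"
proof
  assume nl: "\<not> legendre_form m"
  define n where "n = nat m"
  have m: "m = int n" using assms by (simp add: n_def)
  show "sum_of_three_squares m"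
  proof (cases "n = 0")
    case True
    then show ?thesis unfolding sum_of_three_squares_def m by (intro exI[of _ 0]) simp
  next
    case False
    define k s where "k = squarefree_part n" and "s = square_part n"
    have ks: "n = k * s\<^sup>2" unfolding k_def s_def by (rule squarefree_decompose)
    have "s > 0" using False ks by (intro Nat.gr0I) auto
    then obtain e r where er: "s = 2 ^ e * r" "odd r" using nat_two_power_odd by blast
    \<comment> \<open>The square of the odd part of \<open>s\<close> is 1 modulo 8, so a squarefree
      part 7 modulo 8 would put \<open>n\<close> itself into the excluded form.\<close>
    have "k mod 8 \<noteq> 7"
    proof
      assume k7: "k mod 8 = 7"
      have "r mod 8 = 1 \<or> r mod 8 = 3 \<or> r mod 8 = 5 \<or> r mod 8 = 7" using er(2) by presburger
      then have "r\<^sup>2 mod 8 = 1" using power_mod[of r 8 2] by auto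
      then have kr: "k * r\<^sup>2 mod 8 = 7" using k7 mod_mult_eq[of k 8 "r\<^sup>2"] by simp
      have "int n = 2 ^ (2 * e) * int (k * r\<^sup>2)" by (simp add: ks er(1) power_mult_distrib power_mult mult.commute)
      moreover have "odd (int (k * r\<^sup>2))" "int (k * r\<^sup>2) > 0" "[int (k * r\<^sup>2) = 7] (mod 8)"
      proof -
        have "[k * r\<^sup>2 = 7] (mod 8)" using kr by (simp add: cong_def)
        then have "[int (k * r\<^sup>2) = int 7] (mod int 8)" by (simp only: cong_int_iff)
        then show "[int (k * r\<^sup>2) = 7] (mod 8)" by (simp only: of_nat_numeral)
        show "odd (int (k * r\<^sup>2))" using kr unfolding even_of_nat by presburger
        then show "int (k * r\<^sup>2) > 0" by (cases "k * r\<^sup>2 = 0") auto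
      qed
      ultimately have "legendre_form (int n)" using legendre_form_iff by simp
      then show False using nl m by simp
    qed
    then have "sum_of_three_squares (int k)" by (intro squarefree_sum_of_three_squares) (simp_all add: k_def)
    then obtain x y z where "int k = x\<^sup>2 + y\<^sup>2 + z\<^sup>2" by (auto simp: sum_of_three_squares_def)
    then have "m = (x * int s)\<^sup>2 + (y * int s)\<^sup>2 + (z * int s)\<^sup>2"
      by (simp add: m ks power_mult_distrib flip: distrib_right)
    then show ?thesis unfolding sum_of_three_squares_def by blast
  qed
qed (use legendre_form_not_sum_of_three_squares in blast)

theorem theorem5p4:
  fixes A B :: int and \<pi> :: nat
  assumes "\<not> 2 dvd B"
    and "nondegenerate A B"
    and "\<forall>n. lucas_u A B n \<ge> 0"
    and "\<pi> = (if 2 dvd A then 4 else 6)"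
  shows "\<exists>\<S> :: nat set set. finite \<S> \<and>
    (\<forall>S\<in>\<S>.
        (\<exists>t j :: nat. j \<in> {1..2 ^ t * \<pi> - 1} \<and> S = {2 ^ t * \<pi> * l + j | l. l \<in> (UNIV :: nat set)})
      \<or> (\<exists>t c :: nat. c \<in> {0..7} \<and>
            S = {2 ^ (t + 2 * k) * \<pi> * (8 * l + c) | k l. k \<in> (UNIV :: nat set) \<and> l \<in> (UNIV :: nat set)})) \<and>
    {n. \<not> sum_of_three_squares (lucas_u A B n)} = \<Union>\<S>"
proof -
  have "\<not> sum_of_three_squares (lucas_u A B n) \<longleftrightarrow> legendre_form (lucas_u A B n)" for n
    using three_squares[of "lucas_u A B n"] assms(3) by blast
  then show ?thesis using lucas_legendre_form_set[of B A \<pi>] assms by simp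
qed

end
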